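(* Let $T$ be a (possibly empty) subset of $\{1,\ldots,n\}$, let $U_1,\ldots,U_\ell$ be pairwise disjoint nonempty sets with union $\{1,\ldots,n\}\setminus T$, and let $\mathbf{S}_i$ be a standard ordered set partition of $U_i$ for $i=1,\ldots,\ell$. Let $m=1+|\mathbf{S}_1|+\cdots+|\mathbf{S}_\ell|$, where $|\mathbf{S}_i|$ is the number of blocks of $\mathbf{S}_i$. Then $$[(T,\mathbf{S}_1)]\bullet\cdots\bullet[(T,\mathbf{S}_\ell)]=\sum_{\mathbf{U}}(-1)^{m-|\mathbf{U}|}[(\mathbf{U})],$$ where the sum is over all standard ordered set partitions $\mathbf{U}=(U'_1,\ldots,U'_k)$ of $\{1,\ldots,n\}$ such that each of $(T,\mathbf{S}_1),\ldots,(T,\mathbf{S}_\ell)$ is a subword of some cyclic block rotation of $\mathbf{U}$, and $|\mathbf{U}|=k$ is its number of blocks.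
   Context: $V_0^n=\{x\in\mathbb{R}^n:\sum_ix_i=0\}$. For $C\subseteq V_0^n$, $[C]$ is its characteristic function; $\bullet$ is the convolution, the unique bilinear product on the span of characteristic functions of closed polyhedral cones in $V_0^n$ with $[C_1]\bullet[C_2]=[C_1\oplus C_2]$ (Minkowski sum). An ordered set partition (OSP) of a set $U$ is a sequence of nonempty pairwise disjoint blocks with union $U$; standard if the first block contains $\min U$. $(T,\mathbf{S}_i)$ denotes the OSP of $T\cup U_i$ obtained by prepending the block $T$ to $\mathbf{S}_i$ (with $T$ omitted if empty). For an OSP $(V_1,\ldots,V_a)$ of a subset $U\subseteq\{1,\ldots,n\}$ with $x_S:=\sum_{i\in S}x_i$, the plate $[V_1,\ldots,V_a]=\{x\in V_0^n: x_i=0\ (i\notin U),\ x_{V_1\cup\cdots\cup V_j}\ge0\ (j=1,\ldots,a-1)\}$, with characteristic function $[[V_1,\ldots,V_a]]$; the graduated blade function is the cyclic sum $[(V_1,\ldots,V_a)]=[[V_1,V_2,\ldots,V_a]]+[[V_2,\ldots,V_a,V_1]]+\cdots+[[V_a,V_1,\ldots,V_{a-1}]]$. An OSP $\mathbf{A}$ of a set $A$ is a subword of an OSP $\mathbf{B}$ of a superset of $A$ if intersecting each block of $\mathbf{B}$ with $A$ and deleting empty blocks yields $\mathbf{A}$. A cyclic block rotation of $(U'_1,\ldots,U'_k)$ is $(U'_j,\ldots,U'_k,U'_1,\ldots,U'_{j-1})$.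
   Formalization: For T empty, m is taken as |S_1|+…+|S_ℓ| without the leading 1 (the printed m gives the wrong global sign, e.g. n=ℓ=1, T=∅, S_1=({1})); for T nonempty m is as printed; ℓ≥1 is assumed. *)

theory Defs
  imports "HOL-Analysis.Analysis"
begin

text \<open>
  The coordinate set \<open>{1,...,n}\<close> is an arbitrary finite linearly ordered type \<open>'n\<close>, with
  \<open>n = CARD('n)\<close>; the order is only used to single out minima of subsets.
\<close>

definition V0 :: "(real^'n) set" where
  "V0 = {x. (\<Sum>i\<in>UNIV. x $ i) = 0}"

definition polyhedral_cone :: "(real^'n) set \<Rightarrow> bool" where
  "polyhedral_cone C \<longleftrightarrow> polyhedron C \<and> convex_cone C \<and> C \<subseteq> V0"

definition minkowski_sum :: "(real^'n) set \<Rightarrow> (real^'n) set \<Rightarrow> (real^'n) set" where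
  "minkowski_sum C D = {x + y | x y. x \<in> C \<and> y \<in> D}"

definition cone_span :: "(real^'n \<Rightarrow> real) set" where
  "cone_span = {f. \<exists>F a. finite F \<and> (\<forall>C\<in>F. polyhedral_cone C) \<and>
                     f = (\<lambda>x. \<Sum>C\<in>F. a C * indicator C x)}"

text \<open>
  The last conjunct only fixes the junk value outside the span, so that the product is unique as
  a total HOL function.
\<close>

definition is_convolution ::
    "((real^'n \<Rightarrow> real) \<Rightarrow> (real^'n \<Rightarrow> real) \<Rightarrow> (real^'n \<Rightarrow> real)) \<Rightarrow> bool" where
  "is_convolution p \<longleftrightarrow>
     (\<forall>f\<in>cone_span. \<forall>g\<in>cone_span. p f g \<in> cone_span) \<and>
     (\<forall>f\<in>cone_span. \<forall>g\<in>cone_span. \<forall>h\<in>cone_span. \<forall>a b.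
        p (\<lambda>x. a * f x + b * g x) h = (\<lambda>x. a * p f h x + b * p g h x)) \<and>
     (\<forall>f\<in>cone_span. \<forall>g\<in>cone_span. \<forall>h\<in>cone_span. \<forall>a b.
        p h (\<lambda>x. a * f x + b * g x) = (\<lambda>x. a * p h f x + b * p h g x)) \<and>
     (\<forall>C D. polyhedral_cone C \<longrightarrow> polyhedral_cone D \<longrightarrow>
        p (indicator C) (indicator D) = indicator (minkowski_sum C D)) \<and>
     (\<forall>f g. f \<notin> cone_span \<or> g \<notin> cone_span \<longrightarrow> p f g = (\<lambda>x. 0))"

definition convolution ::
    "(real^'n \<Rightarrow> real) \<Rightarrow> (real^'n \<Rightarrow> real) \<Rightarrow> (real^'n \<Rightarrow> real)" (infixl \<open>\<bullet>\<^sub>c\<close> 70) where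
  "convolution = (THE p. is_convolution p)"

text \<open>\<open>F 1 \<bullet>\<^sub>c \<dots> \<bullet>\<^sub>c F l\<close>, meaningful for \<open>l \<ge> 1\<close>\<close>

definition convolution_prod :: "nat \<Rightarrow> (nat \<Rightarrow> real^'n \<Rightarrow> real) \<Rightarrow> (real^'n \<Rightarrow> real)" where
  "convolution_prod l F = foldl (\<bullet>\<^sub>c) (F 1) (map F [2..<Suc l])"

definition osp :: "'a set \<Rightarrow> 'a set list \<Rightarrow> bool" where
  "osp U Vs \<longleftrightarrow> distinct Vs \<and> partition_on U (set Vs)"

definition standard_osp :: "'a::linorder set \<Rightarrow> 'a set list \<Rightarrow> bool" where
  "standard_osp U Vs \<longleftrightarrow> osp U Vs \<and> Min U \<in> hd Vs"

definition prepend_block :: "'a set \<Rightarrow> 'a set list \<Rightarrow> 'a set list" where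
  "prepend_block T Vs = (if T = {} then Vs else T # Vs)"

definition subword :: "'a set list \<Rightarrow> 'a set list \<Rightarrow> bool" where
  "subword As Bs \<longleftrightarrow> filter (\<lambda>V. V \<noteq> {}) (map (\<lambda>B. B \<inter> \<Union>(set As)) Bs) = As"

definition plate :: "'n set list \<Rightarrow> (real^'n) set" where
  "plate Vs = {x \<in> V0. (\<forall>i. i \<notin> \<Union>(set Vs) \<longrightarrow> x $ i = 0) \<and>
                       (\<forall>j\<in>{1..<length Vs}. (\<Sum>i\<in>\<Union>(set (take j Vs)). x $ i) \<ge> 0)}"

definition blade :: "'n set list \<Rightarrow> (real^'n \<Rightarrow> real)" where
  "blade Vs = (\<lambda>x. \<Sum>j<length Vs. indicator (plate (rotate j Vs)) x)"

end

theory Submission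
  imports Defs
begin

text \<open>
  Minkowski addition of a ray sends a vanishing combination of closed polyhedral cones to a vanishing
  combination, because on each line this is a statement about closed intervals; polyhedral cones
  being finitely generated, the convolution exists. Convolving with halfspaces shows that
  \<open>[C] \<mapsto> [C\<^sup>*]\<close> (dual cones inside \<open>V0\<close>) extends to an injective linear map turning the convolution
  into the pointwise product. The dual of a plate consists of the \<open>y\<close> that are weakly decreasing along
  its blocks, so the theorem becomes, for each fixed \<open>y\<close>, a count of ordered set partitions along
  which \<open>y\<close> decreases. Summing over rotations removes the cyclic structure, and what remains is that
  the ordered set partitions of a finite poset \<open>N\<close> compatible with its strict order, counted with sign
  \<open>(-1)\<close> to the number of blocks, give \<open>(-1) ^ card N\<close>: the first block is an arbitrary nonempty set of
  minimal elements.
\<close>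

section \<open>Polyhedral cones\<close>

text \<open>For fixed \<open>y\<close> the dual of the left side is a product over \<open>i\<close>
  of the number of rotations of \<open>(T, S i)\<close> along which \<open>y\<close> decreases, that
  is, a sum over tuples of rotations. On the right, a standard partition together with a rotation
  index amounts to an arbitrary ordered set partition \<open>V\<close> of the whole set, and the
  cyclic condition says that \<open>V\<close> has some rotation of each word as a linear subword.
  This tuple of rotations is determined by \<open>V\<close>, so the identity splits into one linear
  identity per tuple. There the elements of the poset are the distinct blocks of the rotated words,
  ordered by the words and by strict decrease of \<open>y\<close>. The obstacle is acyclicity: after
  rotation \<open>T\<close> may stand anywhere in its word. But two words share no elements outside
  \<open>T\<close>, so they can be aligned along it. The number of blocks does not depend on the
  rotations; it is \<open>m\<close>, with \<open>T\<close> counted once, and this produces the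
  sign.\<close>

lemma polyhedron_homogeneous:
  fixes A :: "'a::euclidean_space set"
  assumes "finite A"
  shows "polyhedron {x. \<forall>a\<in>A. a \<bullet> x \<le> 0}" "convex_cone {x. \<forall>a\<in>A. a \<bullet> x \<le> 0}"
proof -
  have *: "{x. \<forall>a\<in>A. a \<bullet> x \<le> 0} = \<Inter>((\<lambda>a. {x. a \<bullet> x \<le> 0}) ` A)" by auto
  show "polyhedron {x. \<forall>a\<in>A. a \<bullet> x \<le> 0}"
    unfolding * using assms by (intro polyhedron_Inter) (auto simp: polyhedron_halfspace_le)
  show "convex_cone {x. \<forall>a\<in>A. a \<bullet> x \<le> 0}"
    unfolding * by (intro convex_cone_Inter) (auto simp: convex_cone_halfspace_le)
qed

text \<open>Since 0 lies in the cone, every right-hand side \<open>b h\<close> is nonnegative; if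
  some \<open>a h\<close> were positive at a point of the cone, a large multiple of that point would
  violate its inequality. So all right-hand sides may be replaced by 0.\<close>

lemma polyhedral_convex_cone_homogeneous:
  fixes C :: "'a::euclidean_space set"
  assumes "polyhedron C" "convex_cone C"
  obtains A where "finite A" "C = {x. \<forall>a\<in>A. a \<bullet> x \<le> 0}"
proof -
  obtain F where F: "finite F" "C = \<Inter>F" "\<forall>h\<in>F. \<exists>a b. a \<noteq> 0 \<and> h = {x. a \<bullet> x \<le> b}"
    using assms(1) unfolding polyhedron_def by blast
  obtain a b where ab: "\<And>h. h \<in> F \<Longrightarrow> h = {x. a h \<bullet> x \<le> b h}"
    using F(3) by metis
  have 0: "0 \<in> C" using assms(2) by (rule convex_cone_contains_0)
  have b0: "b h \<ge> 0" if "h \<in> F" for h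
  proof -
    have "0 \<in> {x. a h \<bullet> x \<le> b h}" using ab[OF that] 0 F(2) that by blast
    then show ?thesis by simp
  qed
  have "C = {x. \<forall>c\<in>a ` F. c \<bullet> x \<le> 0}"
  proof (intro equalityI subsetI CollectI ballI)
    fix x c assume x: "x \<in> C" and "c \<in> a ` F"
    then obtain h where h: "h \<in> F" "c = a h" by blast
    show "c \<bullet> x \<le> 0"
    proof (rule ccontr)
      assume "\<not> c \<bullet> x \<le> 0"
      then have pos: "c \<bullet> x > 0" by simp
      define t where "t = (b h + 1) / (c \<bullet> x)"
      have "t \<ge> 0" using b0[OF h(1)] pos by (simp add: t_def)
      then have "t *\<^sub>R x \<in> C" using assms(2) x convex_cone_scaleR by blast
      then have "t *\<^sub>R x \<in> {x. a h \<bullet> x \<le> b h}" using F(2) ab h(1) by blast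
      then have "c \<bullet> (t *\<^sub>R x) \<le> b h" using h(2) by simp
      then show False using pos by (simp add: t_def)
    qed
  next
    fix x assume "x \<in> {x. \<forall>c\<in>a ` F. c \<bullet> x \<le> 0}"
    then have "x \<in> h" if "h \<in> F" for h
    proof -
      have "x \<in> {x. a h \<bullet> x \<le> b h}" using \<open>x \<in> _\<close> b0[OF that] that by force
      then show ?thesis using ab[OF that] by simp
    qed
    then show "x \<in> C" using F(2) by blast
  qed
  then show ?thesis using that[of "a ` F"] F(1) by blast
qed

text \<open>The part of the cone inside a box is a polytope, and every point of the cone has a
  positive multiple in the box. So the finitely many points spanning the polytope generate the
  cone.\<close>

lemma polyhedral_convex_cone_finitely_generated:
  fixes C :: "'a::euclidean_space set"
  assumes "polyhedron C" "convex_cone C"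
  obtains S where "finite S" "C = convex_cone hull S"
proof -
  let ?B = "cbox (- One) One :: 'a set"
  have "polytope (C \<inter> ?B)"
    by (intro polyhedron_Int_polytope assms polytope_interval)
  then obtain S where S: "finite S" "C \<inter> ?B = convex hull S"
    unfolding polytope_def by blast
  have "S \<subseteq> C" using S(2) hull_subset[of S convex] by blast
  then have "convex_cone hull S \<subseteq> C" using assms(2) by (simp add: hull_minimal)
  moreover have "C \<subseteq> convex_cone hull S"
  proof
    fix x assume x: "x \<in> C"
    define t where "t = 1 / (1 + norm x)"
    have t: "t > 0" by (simp add: t_def add_pos_nonneg)
    have "norm (t *\<^sub>R x) \<le> 1"
      by (simp add: t_def divide_simps) (smt (verit) norm_ge_zero)
    then have "t *\<^sub>R x \<in> ?B"
      using Basis_le_norm[of _ "t *\<^sub>R x"] by (fastforce simp: mem_box abs_le_iff)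
    moreover have "t *\<^sub>R x \<in> C" using assms(2) x t convex_cone_scaleR by (metis less_imp_le)
    ultimately have "t *\<^sub>R x \<in> convex_cone hull S"
      using S(2) convex_hull_subset_convex_cone_hull by blast
    then have "(1/t) *\<^sub>R (t *\<^sub>R x) \<in> convex_cone hull S"
      by (rule convex_cone_hull_mul) (use t in simp)
    moreover have "(1/t) *\<^sub>R (t *\<^sub>R x) = x" using t by simp
    ultimately show "x \<in> convex_cone hull S" by (simp only:)
  qed
  ultimately show ?thesis using that S(1) by blast
qed

section \<open>Adding a ray to a polyhedral cone\<close>

definition ray :: "'a::real_vector \<Rightarrow> 'a set" where
  "ray v = (\<lambda>t. t *\<^sub>R v) ` {0..}"

lemma convex_cone_hull_singleton: "convex_cone hull {v} = ray v"
  by (auto simp: convex_cone_hull_convex_hull_nonempty ray_def)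

lemma mem_minkowski_sum_ray:
  "x \<in> minkowski_sum K (ray v) \<longleftrightarrow> (\<exists>t\<ge>0. x - t *\<^sub>R v \<in> K)"
  unfolding minkowski_sum_def ray_def
  by (auto simp: algebra_simps) (metis add_diff_cancel_right' atLeast_iff diff_add_cancel image_eqI)

text \<open>Adding a finitely generated cone amounts to adding rays one at a time, which reduces
  both polyhedrality and the preservation of linear relations to a single ray.\<close>

lemma minkowski_sum_hull_insert:
  "minkowski_sum K (convex_cone hull (insert v S)) =
   minkowski_sum (minkowski_sum K (convex_cone hull S)) (ray v)"
proof -
  have "convex_cone hull (insert v S) = (\<Union>x \<in> convex_cone hull S. \<Union>y \<in> ray v. {x + y})"
    using convex_cone_hull_Un[of S "{v}"] by (simp add: convex_cone_hull_singleton)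
  then show ?thesis unfolding minkowski_sum_def by auto (metis add.assoc)+
qed

text \<open>Fourier--Motzkin elimination of the ray parameter.\<close>

lemma minkowski_sum_ray_homogeneous:
  fixes A :: "(real^'n) set"
  assumes "finite A"
  obtains B where "finite B"
    "minkowski_sum {x. \<forall>a\<in>A. a \<bullet> x \<le> 0} (ray v) = {x. \<forall>b\<in>B. b \<bullet> x \<le> 0}"
proof -
  define P where "P = {a\<in>A. a \<bullet> v > 0}"
  define N where "N = {a\<in>A. a \<bullet> v < 0}"
  define Z where "Z = {a\<in>A. a \<bullet> v \<le> 0}"
  \<comment> \<open>The parameters \<open>t\<close> admissible for \<open>x\<close> satisfy
    \<open>p \<bullet> x / (p \<bullet> v) \<le> t\<close> for \<open>p\<close> in \<open>P\<close>,
    \<open>t \<le> q \<bullet> x / (q \<bullet> v)\<close> for \<open>q\<close> in \<open>N\<close>,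
    and \<open>t \<ge> 0\<close>; \<open>comb (p, q)\<close> compares a lower with an upper bound.
    \<open>N\<close> is also contained in \<open>Z\<close>, since the upper bounds must be
    nonnegative.\<close>
  define comb where "comb = (\<lambda>(p, q). (1 / (p \<bullet> v)) *\<^sub>R p - (1 / (q \<bullet> v)) *\<^sub>R q)"
  define B where "B = Z \<union> comb ` (P \<times> N)"
  have fin: "finite P" "finite N" "finite Z" using assms by (auto simp: P_def N_def Z_def)
  have comb: "comb (p, q) \<bullet> x = p \<bullet> x / (p \<bullet> v) - q \<bullet> x / (q \<bullet> v)" for p q x
    by (simp add: comb_def inner_diff_left)
  have "minkowski_sum {x. \<forall>a\<in>A. a \<bullet> x \<le> 0} (ray v) = {x. \<forall>b\<in>B. b \<bullet> x \<le> 0}"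
  proof (intro equalityI subsetI CollectI ballI)
    fix x b assume x: "x \<in> minkowski_sum {x. \<forall>a\<in>A. a \<bullet> x \<le> 0} (ray v)" and b: "b \<in> B"
    obtain t where t: "t \<ge> 0" "\<And>a. a \<in> A \<Longrightarrow> a \<bullet> x \<le> t * (a \<bullet> v)"
      using x unfolding mem_minkowski_sum_ray by (auto simp: inner_diff_right)
    consider "b \<in> Z" | p q where "p \<in> P" "q \<in> N" "b = comb (p, q)"
      using b unfolding B_def by blast
    then show "b \<bullet> x \<le> 0"
    proof cases
      case 1
      then have "b \<bullet> x \<le> t * (b \<bullet> v)" "t * (b \<bullet> v) \<le> 0" using t by (auto simp: Z_def mult_le_0_iff)
      then show ?thesis by simp
    next
      case 2
      then have "p \<bullet> x / (p \<bullet> v) \<le> t" "t \<le> q \<bullet> x / (q \<bullet> v)"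
        using t(2)[of p] t(2)[of q] by (auto simp: P_def N_def pos_divide_le_eq neg_le_divide_eq)
      then show ?thesis using 2 comb by simp
    qed
  next
    fix x assume x: "x \<in> {x. \<forall>b\<in>B. b \<bullet> x \<le> 0}"
    \<comment> \<open>The least parameter allowed by the lower bounds. It is 0 or one of them, so a
      single inequality from \<open>B\<close> compares it with each upper bound.\<close>
    define t where "t = Max (insert 0 ((\<lambda>p. p \<bullet> x / (p \<bullet> v)) ` P))"
    have t0: "t \<ge> 0" and tP: "\<And>p. p \<in> P \<Longrightarrow> p \<bullet> x / (p \<bullet> v) \<le> t"
      using fin by (auto simp: t_def)
    have "t \<in> insert 0 ((\<lambda>p. p \<bullet> x / (p \<bullet> v)) ` P)"
      unfolding t_def using fin by (intro Max_in) auto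
    then have tN: "t \<le> q \<bullet> x / (q \<bullet> v)" if "q \<in> N" for q
    proof (elim insertE imageE)
      assume "t = 0"
      have "q \<in> B" using that by (auto simp: B_def N_def Z_def)
      then show ?thesis using \<open>t = 0\<close> x that by (auto simp: N_def divide_nonpos_neg)
    next
      fix p assume tp: "t = p \<bullet> x / (p \<bullet> v)" "p \<in> P"
      then have "comb (p, q) \<bullet> x \<le> 0" using x that unfolding B_def by blast
      then show ?thesis using comb[of p q x] tp by simp
    qed
    have "a \<bullet> (x - t *\<^sub>R v) \<le> 0" if aA: "a \<in> A" for a
    proof -
      consider "a \<in> P" | "a \<in> N" | "a \<in> Z" "a \<bullet> v = 0"
        using aA by (cases "a \<bullet> v" "0::real" rule: linorder_cases) (auto simp: P_def N_def Z_def)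
      then show ?thesis
      proof cases
        case 1 then show ?thesis using tP[of a]
          by (auto simp: P_def pos_divide_le_eq inner_diff_right)
      next
        case 2 then show ?thesis using tN[of a]
          by (auto simp: N_def neg_le_divide_eq inner_diff_right)
      next
        case 3 then show ?thesis using x by (auto simp: B_def inner_diff_right)
      qed
    qed
    then show "x \<in> minkowski_sum {x. \<forall>a\<in>A. a \<bullet> x \<le> 0} (ray v)"
      unfolding mem_minkowski_sum_ray using t0 by blast
  qed
  then show ?thesis using that[of B] fin by (simp add: B_def)
qed

lemma minkowski_sum_ray_polyhedron:
  fixes C :: "(real^'n) set"
  assumes "polyhedron C" "convex_cone C"
  shows "polyhedron (minkowski_sum C (ray v))" "convex_cone (minkowski_sum C (ray v))"
proof -
  obtain A where A: "finite A" "C = {x. \<forall>a\<in>A. a \<bullet> x \<le> 0}"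
    using assms by (rule polyhedral_convex_cone_homogeneous)
  obtain B where B: "finite B" "minkowski_sum C (ray v) = {x. \<forall>b\<in>B. b \<bullet> x \<le> 0}"
    unfolding A(2) using A(1) by (rule minkowski_sum_ray_homogeneous)
  show "polyhedron (minkowski_sum C (ray v))" "convex_cone (minkowski_sum C (ray v))"
    unfolding B(2) by (rule polyhedron_homogeneous[OF B(1)])+
qed

lemma minkowski_sum_zero: "minkowski_sum K {0} = K"
  by (auto simp: minkowski_sum_def)

lemma minkowski_sum_hull_polyhedron:
  fixes C :: "(real^'n) set"
  assumes "finite S" "polyhedron C" "convex_cone C"
  shows "polyhedron (minkowski_sum C (convex_cone hull S)) \<and>
         convex_cone (minkowski_sum C (convex_cone hull S))"
  using assms(1)
  by (induction S) (simp_all add: minkowski_sum_zero assms minkowski_sum_hull_insert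
      minkowski_sum_ray_polyhedron)

lemma subspace_V0: "subspace V0"
  by (auto simp: subspace_def V0_def sum.distrib simp flip: sum_distrib_left)

lemma polyhedral_cone_minkowski_sum:
  assumes "polyhedral_cone C" "polyhedral_cone D"
  shows "polyhedral_cone (minkowski_sum C D)"
proof -
  obtain S where S: "finite S" "D = convex_cone hull S"
    using assms(2) polyhedral_convex_cone_finitely_generated unfolding polyhedral_cone_def by metis
  have "minkowski_sum C D \<subseteq> V0"
    using assms subspace_add[OF subspace_V0] unfolding polyhedral_cone_def minkowski_sum_def by blast
  then show ?thesis
    using minkowski_sum_hull_polyhedron[OF S(1), of C] assms S(2) by (simp add: polyhedral_cone_def)
qed

text \<open>A nonempty closed interval bounded below contributes exactly at its left endpoint to the
  jump \<open>f l - f (l-)\<close> of \<open>f = \<Sum> a\<^sub>i [J\<^sub>i]\<close>.\<close>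

lemma sum_nonempty_intervals_eq_0:
  fixes J :: "'i \<Rightarrow> real set" and a :: "'i \<Rightarrow> real"
  assumes "finite I"
    and J: "\<And>i. i \<in> I \<Longrightarrow> closed (J i)" "\<And>i. i \<in> I \<Longrightarrow> convex (J i)" "\<And>i. i \<in> I \<Longrightarrow> J i \<subseteq> {0..}"
    and zero: "\<And>t. (\<Sum>i\<in>I. a i * indicator (J i) t) = 0"
  shows "(\<Sum>i | i \<in> I \<and> J i \<noteq> {}. a i) = 0"
proof -
  define L where "L i = Inf (J i)" for i
  define I' where "I' = {i \<in> I. J i \<noteq> {}}"
  have fin: "finite I'" using assms(1) by (simp add: I'_def)
  have bdd: "bdd_below (J i)" if "i \<in> I" for i
    using J(3)[OF that] by (metis bdd_below_Ici bdd_below_mono)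
  have L_in: "L i \<in> J i" if "i \<in> I'" for i
    unfolding L_def using that J bdd by (intro closed_contains_Inf) (auto simp: I'_def)
  have L_le: "L i \<le> t" if "i \<in> I" "t \<in> J i" for i t
    unfolding L_def using that bdd by (intro cInf_lower) auto
  have jump: "(\<Sum>i | i \<in> I' \<and> L i = l. a i) = 0" for l
  proof -
    \<comment> \<open>Just below \<open>l\<close> the intervals met are those through
      \<open>l\<close> that do not start there; closedness excludes any others. Comparing the
      vanishing sums at \<open>l\<close> and at one common \<open>t\<close> below it isolates the
      intervals that start at \<open>l\<close>.\<close>
    have "eventually (\<lambda>t. t \<in> J i \<longleftrightarrow> l \<in> J i \<and> L i \<noteq> l) (at_left l)" if i: "i \<in> I" for i
    proof (cases "l \<in> J i")
      case False
      have "eventually (\<lambda>t. t \<in> - J i) (nhds l)"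
        using J(1)[OF i] False by (intro eventually_nhds_in_open) auto
      then have "eventually (\<lambda>t. t \<in> - J i) (at_left l)"
        by (simp add: eventually_at_filter eventually_mono)
      then show ?thesis by eventually_elim (use False in auto)
    next
      case True
      then have i': "i \<in> I'" using i by (auto simp: I'_def)
      show ?thesis
      proof (cases "L i = l")
        case True
        have "eventually (\<lambda>t. t < l) (at_left l)" by (simp add: eventually_at_filter)
        then show ?thesis by eventually_elim (use L_le[OF i] True in force)
      next
        case neq: False
        then have "L i < l" using L_le[OF i True] by simp
        then have "eventually (\<lambda>t. t \<in> {L i<..<l}) (at_left l)"
          by (rule eventually_at_left_real)
        then show ?thesis
        proof eventually_elim
          case (elim t)
          then have "t \<in> J i"
            using L_in[OF i'] True J(2)[OF i] mem_is_interval_1_I[of "J i" "L i" l t]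
            by (auto simp: is_interval_convex_1)
          then show ?case using True neq by simp
        qed
      qed
    qed
    then have "eventually (\<lambda>t. \<forall>i\<in>I. t \<in> J i \<longleftrightarrow> l \<in> J i \<and> L i \<noteq> l) (at_left l)"
      using assms(1) by (simp add: eventually_ball_finite_distrib)
    then obtain t where t: "\<forall>i\<in>I. t \<in> J i \<longleftrightarrow> l \<in> J i \<and> L i \<noteq> l"
      using eventually_happens trivial_limit_at_left_real by blast
    have "(\<Sum>i | i \<in> I' \<and> L i = l. a i) = (\<Sum>i\<in>I. if i \<in> I' \<and> L i = l then a i else 0)"
      using assms(1) by (subst sum.inter_filter[symmetric]) (auto simp: I'_def intro!: sum.cong)
    also have "\<dots> = (\<Sum>i\<in>I. a i * indicator (J i) l - a i * indicator (J i) t)"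
      using t L_in by (intro sum.cong) (auto simp: I'_def indicator_def)
    also have "\<dots> = 0" by (simp add: sum_subtractf zero)
    finally show ?thesis .
  qed
  have "(\<Sum>i\<in>I'. a i) = (\<Sum>l\<in>L ` I'. \<Sum>i | i \<in> I' \<and> L i = l. a i)"
    using fin by (rule sum.image_gen)
  then show ?thesis using jump by (simp add: I'_def)
qed

text \<open>The point \<open>x\<close> lies in the sum of \<open>K i\<close> and the ray exactly
  when the interval of parameters \<open>t \<ge> 0\<close> with \<open>x - t *\<^sub>R v\<close> in
  \<open>K i\<close> is nonempty. These intervals inherit the linear relation pointwise in
  \<open>t\<close>, so the coefficients of the nonempty ones add up to 0.\<close>

lemma sum_minkowski_ray_eq_0:
  fixes K :: "'i \<Rightarrow> (real^'n) set"
  assumes "finite I" and K: "\<And>i. i \<in> I \<Longrightarrow> closed (K i)" "\<And>i. i \<in> I \<Longrightarrow> convex (K i)"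
    and zero: "\<And>x. (\<Sum>i\<in>I. a i * indicator (K i) x) = (0::real)"
  shows "(\<Sum>i\<in>I. a i * indicator (minkowski_sum (K i) (ray v)) x) = 0"
proof -
  define J where "J i = {0..} \<inter> (\<lambda>t. x + t *\<^sub>R (- v)) -` K i" for i
  have "(\<Sum>i | i \<in> I \<and> J i \<noteq> {}. a i) = 0"
  proof (rule sum_nonempty_intervals_eq_0)
    fix i assume i: "i \<in> I"
    have "closed ((\<lambda>t::real. x + t *\<^sub>R (- v)) -` K i)"
      by (intro closed_vimage K i continuous_intros)
    then show "closed (J i)" unfolding J_def by blast
    have "convex ((\<lambda>t::real. x + t *\<^sub>R (- v)) -` K i)"
    proof (rule convexI)
      fix s t u w :: real
      assume *: "s \<in> (\<lambda>t. x + t *\<^sub>R - v) -` K i" "t \<in> (\<lambda>t. x + t *\<^sub>R - v) -` K i"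
        "0 \<le> u" "0 \<le> w" "u + w = 1"
      have "x + (u *\<^sub>R s + w *\<^sub>R t) *\<^sub>R - v = u *\<^sub>R (x + s *\<^sub>R - v) + w *\<^sub>R (x + t *\<^sub>R - v)"
        using *(5) by (simp add: algebra_simps flip: scaleR_add_left)
      then show "u *\<^sub>R s + w *\<^sub>R t \<in> (\<lambda>t. x + t *\<^sub>R - v) -` K i"
        using convexD[OF K(2)[OF i], of "x + s *\<^sub>R - v" "x + t *\<^sub>R - v" u w] * by simp
    qed
    then show "convex (J i)" unfolding J_def by (intro convex_Int convex_real_interval)
    show "J i \<subseteq> {0..}" by (auto simp: J_def)
  next
    fix t
    show "(\<Sum>i\<in>I. a i * indicator (J i) t) = 0"
      using zero[of "x + t *\<^sub>R (- v)"]
      by (cases "t \<ge> 0") (simp_all add: J_def indicator_def)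
  qed (fact assms(1))
  moreover have "J i \<noteq> {} \<longleftrightarrow> x \<in> minkowski_sum (K i) (ray v)" for i
    by (auto simp: J_def mem_minkowski_sum_ray)
  ultimately have "(\<Sum>i | i \<in> I \<and> x \<in> minkowski_sum (K i) (ray v). a i) = 0" by simp
  then show ?thesis
    using assms(1) by (simp add: indicator_def Collect_conj_eq)
qed

text \<open>This is what makes Minkowski addition of \<open>D\<close> a linear map on functions. The
  generators of \<open>D\<close> are added one by one; polyhedrality of the intermediate sums
  provides the closedness required at each ray.\<close>

lemma sum_minkowski_eq_0:
  fixes K :: "'i \<Rightarrow> (real^'n) set"
  assumes "finite I" and K: "\<And>i. i \<in> I \<Longrightarrow> polyhedral_cone (K i)" and D: "polyhedral_cone D"
    and zero: "\<And>x. (\<Sum>i\<in>I. a i * indicator (K i) x) = (0::real)"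
  shows "(\<Sum>i\<in>I. a i * indicator (minkowski_sum (K i) D) x) = 0"
proof -
  obtain S where S: "finite S" "D = convex_cone hull S"
    using D polyhedral_convex_cone_finitely_generated unfolding polyhedral_cone_def by metis
  have "\<forall>x. (\<Sum>i\<in>I. a i * indicator (minkowski_sum (K i) (convex_cone hull S)) x) = 0"
    using S(1)
  proof induction
    case empty
    then show ?case using zero by (simp add: minkowski_sum_zero)
  next
    case (insert v S)
    have "polyhedron (minkowski_sum (K i) (convex_cone hull S))" if "i \<in> I" for i
      using minkowski_sum_hull_polyhedron[OF insert(1)] K[OF that] unfolding polyhedral_cone_def by blast
    then show ?case unfolding minkowski_sum_hull_insert
      using insert.IH assms(1)
      by (intro allI sum_minkowski_ray_eq_0) (auto intro: polyhedron_imp_closed polyhedron_imp_convex)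
  qed
  then show ?thesis using S(2) by simp
qed

section \<open>The convolution\<close>

declare sum_mult_indicator [simp del]

text \<open>The span is defined with sets of cones; an indexed family may repeat a cone, so the
  coefficients of equal cones are collected.\<close>

lemma cone_spanI:
  assumes "finite I" "\<And>i. i \<in> I \<Longrightarrow> polyhedral_cone (K i)"
  shows "(\<lambda>x. \<Sum>i\<in>I. a i * indicator (K i) x) \<in> cone_span"
proof -
  have "(\<Sum>i\<in>I. a i * indicator (K i) x) =
      (\<Sum>C\<in>K ` I. (\<Sum>i | i \<in> I \<and> K i = C. a i) * indicator C x)" for x
    unfolding sum.image_gen[OF assms(1), of _ K] sum_distrib_right
    by (intro sum.cong) auto
  then show ?thesis unfolding cone_span_def using assms
    by (intro CollectI exI[of _ "K ` I"] exI[of _ "\<lambda>C. \<Sum>i | i \<in> I \<and> K i = C. a i"]) auto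
qed

lemma cone_spanE:
  assumes "f \<in> cone_span"
  obtains F a where "finite F" "\<forall>C\<in>F. polyhedral_cone C"
    "f = (\<lambda>x. \<Sum>C\<in>F. a C * indicator C x)"
  using assms unfolding cone_span_def by blast

lemma cone_span_lincomb:
  assumes "f \<in> cone_span" "g \<in> cone_span"
  shows "(\<lambda>x. a * f x + b * g x) \<in> cone_span"
proof -
  obtain F c where F: "finite F" "\<forall>C\<in>F. polyhedral_cone C"
    "f = (\<lambda>x. \<Sum>C\<in>F. c C * indicator C x)" using assms(1) by (rule cone_spanE) blast
  obtain G d where G: "finite G" "\<forall>C\<in>G. polyhedral_cone C"
    "g = (\<lambda>x. \<Sum>C\<in>G. d C * indicator C x)" using assms(2) by (rule cone_spanE) blast
  have "(\<lambda>x. a * f x + b * g x) =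
    (\<lambda>x. \<Sum>s\<in>F <+> G. case_sum (\<lambda>C. a * c C) (\<lambda>C. b * d C) s * indicator (case_sum id id s) x)"
    using F(1) G(1) by (simp add: F(3) G(3) sum.Plus sum_distrib_left mult.assoc)
  also have "\<dots> \<in> cone_span" using F G by (intro cone_spanI) auto
  finally show ?thesis .
qed

lemma indicator_cone_span: "polyhedral_cone C \<Longrightarrow> indicator C \<in> cone_span"
  using cone_spanI[of "{()}" "\<lambda>_. C" "\<lambda>_. 1"] by simp

lemma zero_cone_span: "(\<lambda>_. 0) \<in> cone_span"
  using cone_spanI[of "{}"] by simp

text \<open>The step is phrased with \<open>1 * f x\<close> so that it is literally an instance of
  the linearity clauses of \<open>is_convolution\<close>.\<close>

lemma cone_span_induct [consumes 1, case_names zero add]: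
  assumes "f \<in> cone_span"
    and "P (\<lambda>_. 0)"
    and "\<And>C a f. polyhedral_cone C \<Longrightarrow> f \<in> cone_span \<Longrightarrow> P f \<Longrightarrow> P (\<lambda>x. a * indicator C x + 1 * f x)"
  shows "P f"
proof -
  obtain F c where F: "finite F" "\<forall>C\<in>F. polyhedral_cone C"
    "f = (\<lambda>x. \<Sum>C\<in>F. c C * indicator C x)" using assms(1) by (rule cone_spanE) blast
  have "P (\<lambda>x. \<Sum>C\<in>F. c C * indicator C x)" using F(1,2)
  proof (induction F)
    case (insert C F)
    then have "P (\<lambda>x. c C * indicator C x + 1 * (\<Sum>C\<in>F. c C * indicator C x))"
      by (intro assms(3) cone_spanI) auto
    then show ?case using insert by simp
  qed (simp add: assms(2))
  then show ?thesis using F(3) by simp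
qed

lemma minkowski_sum_commute: "minkowski_sum C D = minkowski_sum D C"
  unfolding minkowski_sum_def by (metis (no_types, opaque_lifting) add.commute)

text \<open>The difference of the two representations is one vanishing combination, indexed by the
  disjoint union of \<open>I\<close> and \<open>J\<close>.\<close>

lemma sum_minkowski_cong:
  fixes K :: "'i \<Rightarrow> (real^'n) set" and L :: "'j \<Rightarrow> (real^'n) set"
    and a :: "'i \<Rightarrow> real" and b :: "'j \<Rightarrow> real"
  assumes "finite I" "\<And>i. i \<in> I \<Longrightarrow> polyhedral_cone (K i)"
    and "finite J" "\<And>j. j \<in> J \<Longrightarrow> polyhedral_cone (L j)" and D: "polyhedral_cone D"
    and eq: "(\<lambda>x. \<Sum>i\<in>I. a i * indicator (K i) x) = (\<lambda>x. \<Sum>j\<in>J. b j * indicator (L j) x)"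
  shows "(\<Sum>i\<in>I. a i * indicator (minkowski_sum (K i) D) x) =
         (\<Sum>j\<in>J. b j * indicator (minkowski_sum (L j) D) x)"
proof -
  have "(\<Sum>s\<in>I <+> J. case_sum a (\<lambda>j. - b j) s * indicator (minkowski_sum (case_sum K L s) D) x) = 0"
  proof (rule sum_minkowski_eq_0)
    fix x
    show "(\<Sum>s\<in>I <+> J. case_sum a (\<lambda>j. - b j) s * indicator (case_sum K L s) x) = 0"
      using assms(1,3) fun_cong[OF eq, of x] by (simp add: sum.Plus sum_negf)
  qed (use assms in auto)
  then show ?thesis using assms(1,3) by (simp add: sum.Plus sum_negf)
qed

text \<open>The value is computed from an arbitrary pair of representations. These range over sets
  of cones because HOL cannot quantify over index types; independence of the choice is the content
  of \<open>conv_aux_eq\<close>.\<close>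

definition conv_aux :: "(real^'n \<Rightarrow> real) \<Rightarrow> (real^'n \<Rightarrow> real) \<Rightarrow> real^'n \<Rightarrow> real" where
  "conv_aux f g = (SOME h. \<exists>F a G b. finite F \<and> finite G \<and>
     (\<forall>C\<in>F \<union> G. polyhedral_cone C) \<and>
     f = (\<lambda>x. \<Sum>C\<in>F. a C * indicator C x) \<and> g = (\<lambda>x. \<Sum>D\<in>G. b D * indicator D x) \<and>
     h = (\<lambda>x. \<Sum>C\<in>F. \<Sum>D\<in>G. a C * b D * indicator (minkowski_sum C D) x))"

text \<open>The two representations are exchanged one at a time: that of \<open>f\<close> for each
  fixed cone \<open>D\<close> of the other factor, then, by commutativity, that of \<open>g\<close>
  for each fixed \<open>K i\<close>. Arbitrary index types allow sums over disjoint unions, from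
  which linearity is read off.\<close>

lemma conv_aux_eq:
  fixes K :: "'i \<Rightarrow> (real^'n) set" and L :: "'j \<Rightarrow> (real^'n) set"
    and a :: "'i \<Rightarrow> real" and b :: "'j \<Rightarrow> real"
  assumes I: "finite I" "\<forall>i\<in>I. polyhedral_cone (K i)"
    and J: "finite J" "\<forall>j\<in>J. polyhedral_cone (L j)"
    and f: "f = (\<lambda>x. \<Sum>i\<in>I. a i * indicator (K i) x)"
    and g: "g = (\<lambda>x. \<Sum>j\<in>J. b j * indicator (L j) x)"
  shows "conv_aux f g = (\<lambda>x. \<Sum>i\<in>I. \<Sum>j\<in>J. a i * b j * indicator (minkowski_sum (K i) (L j)) x)"
proof -
  have "f \<in> cone_span" "g \<in> cone_span" unfolding f g using I J by (auto intro: cone_spanI)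
  obtain F0 a0 where "finite F0" "\<forall>C\<in>F0. polyhedral_cone C" "f = (\<lambda>x. \<Sum>C\<in>F0. a0 C * indicator C x)"
    using \<open>f \<in> cone_span\<close> by (rule cone_spanE) blast
  moreover obtain G0 b0 where "finite G0" "\<forall>C\<in>G0. polyhedral_cone C" "g = (\<lambda>x. \<Sum>C\<in>G0. b0 C * indicator C x)"
    using \<open>g \<in> cone_span\<close> by (rule cone_spanE) blast
  ultimately have "\<exists>h F a G b. finite F \<and> finite G \<and> (\<forall>C\<in>F \<union> G. polyhedral_cone C) \<and>
     f = (\<lambda>x. \<Sum>C\<in>F. a C * indicator C x) \<and> g = (\<lambda>x. \<Sum>D\<in>G. b D * indicator D x) \<and>
     h = (\<lambda>x. \<Sum>C\<in>F. \<Sum>D\<in>G. a C * b D * indicator (minkowski_sum C D) x)"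
    by (intro exI[of _ F0] exI[of _ a0] exI[of _ G0] exI[of _ b0] exI) auto
  from someI_ex[OF this] obtain F c G d where F: "finite F" "finite G"
    and FG: "\<forall>C\<in>F \<union> G. polyhedral_cone C"
    and f': "f = (\<lambda>x. \<Sum>C\<in>F. c C * indicator C x)" and g': "g = (\<lambda>x. \<Sum>D\<in>G. d D * indicator D x)"
    and h: "conv_aux f g = (\<lambda>x. \<Sum>C\<in>F. \<Sum>D\<in>G. c C * d D * indicator (minkowski_sum C D) x)"
    unfolding conv_aux_def by blast
  have ff: "(\<lambda>x. \<Sum>C\<in>F. c C * indicator C x) = (\<lambda>x. \<Sum>i\<in>I. a i * indicator (K i) x)"
    using f f' by simp
  have gg: "(\<lambda>x. \<Sum>D\<in>G. d D * indicator D x) = (\<lambda>x. \<Sum>j\<in>J. b j * indicator (L j) x)"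
    using g g' by simp
  show ?thesis
  proof
    fix x
    have "conv_aux f g x = (\<Sum>D\<in>G. d D * (\<Sum>C\<in>F. c C * indicator (minkowski_sum C D) x))"
      unfolding h by (subst sum.swap) (simp add: sum_distrib_left mult_ac)
    also have "\<dots> = (\<Sum>D\<in>G. d D * (\<Sum>i\<in>I. a i * indicator (minkowski_sum (K i) D) x))"
      by (intro sum.cong refl arg_cong2[of _ _ _ _ "(*)"] sum_minkowski_cong ff F(1) I(1)) (use FG I in auto)
    also have "\<dots> = (\<Sum>i\<in>I. a i * (\<Sum>D\<in>G. d D * indicator (minkowski_sum D (K i)) x))"
      by (simp add: sum_distrib_left mult_ac minkowski_sum_commute) (rule sum.swap)
    also have "\<dots> = (\<Sum>i\<in>I. a i * (\<Sum>j\<in>J. b j * indicator (minkowski_sum (L j) (K i)) x))"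
      by (intro sum.cong refl arg_cong2[of _ _ _ _ "(*)"] sum_minkowski_cong gg F(2) J(1)) (use FG I J in auto)
    also have "\<dots> = (\<Sum>i\<in>I. \<Sum>j\<in>J. a i * b j * indicator (minkowski_sum (K i) (L j)) x)"
      by (simp add: sum_distrib_left mult_ac minkowski_sum_commute)
    finally show "conv_aux f g x = \<dots>" .
  qed
qed

lemma conv_aux_commute:
  assumes "f \<in> cone_span" "g \<in> cone_span"
  shows "conv_aux f g = conv_aux g f"
proof -
  obtain F c where F: "finite F" "\<forall>C\<in>F. polyhedral_cone C"
    "f = (\<lambda>x. \<Sum>C\<in>F. c C * indicator C x)" using assms(1) by (rule cone_spanE) blast
  obtain G d where G: "finite G" "\<forall>C\<in>G. polyhedral_cone C"
    "g = (\<lambda>x. \<Sum>C\<in>G. d C * indicator C x)" using assms(2) by (rule cone_spanE) blast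
  show ?thesis
    unfolding conv_aux_eq[where K="\<lambda>C. C" and L="\<lambda>C. C", OF F(1,2) G(1,2) F(3) G(3)] conv_aux_eq[where K="\<lambda>C. C" and L="\<lambda>C. C", OF G(1,2) F(1,2) G(3) F(3)]
    by (subst sum.swap) (simp add: minkowski_sum_commute mult_ac)
qed

lemma conv_aux_linear:
  assumes "f \<in> cone_span" "g \<in> cone_span" "h \<in> cone_span"
  shows "conv_aux (\<lambda>x. a * f x + b * g x) h = (\<lambda>x. a * conv_aux f h x + b * conv_aux g h x)"
proof -
  obtain F c where F: "finite F" "\<forall>C\<in>F. polyhedral_cone C"
    "f = (\<lambda>x. \<Sum>C\<in>F. c C * indicator C x)" using assms(1) by (rule cone_spanE) blast
  obtain G d where G: "finite G" "\<forall>C\<in>G. polyhedral_cone C"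
    "g = (\<lambda>x. \<Sum>C\<in>G. d C * indicator C x)" using assms(2) by (rule cone_spanE) blast
  obtain H e where H: "finite H" "\<forall>C\<in>H. polyhedral_cone C"
    "h = (\<lambda>x. \<Sum>C\<in>H. e C * indicator C x)" using assms(3) by (rule cone_spanE) blast
  have FG: "(\<lambda>x. a * f x + b * g x) =
    (\<lambda>x. \<Sum>s\<in>F <+> G. case_sum (\<lambda>C. a * c C) (\<lambda>C. b * d C) s * indicator (case_sum id id s) x)"
    using F(1) G(1) by (simp add: F(3) G(3) sum.Plus sum_distrib_left mult.assoc)
  have "finite (F <+> G)" "\<forall>s\<in>F <+> G. polyhedral_cone (case_sum id id s)"
    using F G by auto
  from conv_aux_eq[where L="\<lambda>C. C", OF this H(1,2) FG H(3)]
  show ?thesis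
    unfolding conv_aux_eq[where K="\<lambda>C. C" and L="\<lambda>C. C", OF F(1,2) H(1,2) F(3) H(3)] conv_aux_eq[where K="\<lambda>C. C" and L="\<lambda>C. C", OF G(1,2) H(1,2) G(3) H(3)]
    using F(1) G(1) by (simp add: sum.Plus sum_distrib_left mult.assoc)
qed

lemma conv_aux_in_cone_span:
  assumes "f \<in> cone_span" "g \<in> cone_span"
  shows "conv_aux f g \<in> cone_span"
proof -
  obtain F c where F: "finite F" "\<forall>C\<in>F. polyhedral_cone C"
    "f = (\<lambda>x. \<Sum>C\<in>F. c C * indicator C x)" using assms(1) by (rule cone_spanE) blast
  obtain G d where G: "finite G" "\<forall>C\<in>G. polyhedral_cone C"
    "g = (\<lambda>x. \<Sum>C\<in>G. d C * indicator C x)" using assms(2) by (rule cone_spanE) blast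
  have "conv_aux f g = (\<lambda>x. \<Sum>s\<in>F \<times> G. (c (fst s) * d (snd s)) *
      indicator (minkowski_sum (fst s) (snd s)) x)"
    unfolding conv_aux_eq[where K="\<lambda>C. C" and L="\<lambda>C. C", OF F(1,2) G(1,2) F(3) G(3)] by (simp add: sum.cartesian_product split_def)
  also have "\<dots> \<in> cone_span"
    using F G by (intro cone_spanI) (auto intro: polyhedral_cone_minkowski_sum)
  finally show ?thesis .
qed

text \<open>Bilinearity determines the product from its values on pairs of cones, by induction on
  one argument and then on the other. The value at the zero function comes from bilinearity with
  both coefficients 0.\<close>

lemma is_convolution_unique:
  fixes p q :: "(real^'n \<Rightarrow> real) \<Rightarrow> (real^'n \<Rightarrow> real) \<Rightarrow> (real^'n \<Rightarrow> real)"
  assumes "is_convolution p" "is_convolution q"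
  shows "p = q"
proof (intro ext)
  fix f g :: "real^'n \<Rightarrow> real" and x
  have left: "r (\<lambda>x. a * f x + b * g x) h = (\<lambda>x. a * r f h x + b * r g h x)"
    if "is_convolution r" "f \<in> cone_span" "g \<in> cone_span" "h \<in> cone_span"
    for r f g a b and h :: "real^'n \<Rightarrow> real"
    using that unfolding is_convolution_def by blast
  have right: "r h (\<lambda>x. a * f x + b * g x) = (\<lambda>x. a * r h f x + b * r h g x)"
    if "is_convolution r" "f \<in> cone_span" "g \<in> cone_span" "h \<in> cone_span"
    for r f g a b and h :: "real^'n \<Rightarrow> real"
    using that unfolding is_convolution_def by blast
  have zl: "r (\<lambda>_. 0) h = (\<lambda>_. 0)" "r h (\<lambda>_. 0) = (\<lambda>_. 0)" if "is_convolution r" "h \<in> cone_span"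
    for r and h :: "real^'n \<Rightarrow> real"
    using left[OF that(1) zero_cone_span zero_cone_span that(2), of 0 0]
      right[OF that(1) zero_cone_span zero_cone_span that(2), of 0 0] by simp_all
  show "p f g x = q f g x"
  proof (cases "f \<in> cone_span \<and> g \<in> cone_span")
    case True
    then have f: "f \<in> cone_span" and g: "g \<in> cone_span" by auto
    have base: "p (indicator C) g = q (indicator C) g" if C: "polyhedral_cone C" for C
      using g
    proof (induction rule: cone_span_induct)
      case zero
      then show ?case using zl assms indicator_cone_span[OF C] by simp
    next
      case (add D a f)
      have "p (indicator C) (indicator D) = q (indicator C) (indicator D)"
        using assms C add(1) unfolding is_convolution_def by simp
      then show ?case
        using right[OF assms(1) indicator_cone_span[OF add(1)] add(2) indicator_cone_span[OF C], of a 1]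
          right[OF assms(2) indicator_cone_span[OF add(1)] add(2) indicator_cone_span[OF C], of a 1] add(3)
        by simp
    qed
    have "p f g = q f g" using f
    proof (induction rule: cone_span_induct)
      case zero
      then show ?case using zl assms g by simp
    next
      case (add D a f)
      then show ?case
        using left[OF assms(1) indicator_cone_span[OF add(1)] add(2) g, of a 1]
          left[OF assms(2) indicator_cone_span[OF add(1)] add(2) g, of a 1] base[OF add(1)]
        by simp
    qed
    then show ?thesis by simp
  next
    case False
    then have "p f g = (\<lambda>x. 0)" "q f g = (\<lambda>x. 0)" using assms unfolding is_convolution_def by blast+
    then show ?thesis by simp
  qed
qed

lemma is_convolution_convolution: "is_convolution (convolution :: (real^'n \<Rightarrow> real) \<Rightarrow> _)"
proof -
  define p where "p f g = (if f \<in> cone_span \<and> g \<in> cone_span then conv_aux f g else (\<lambda>_. 0))"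
    for f g :: "real^'n \<Rightarrow> real"
  have "p (indicator C) (indicator D) = indicator (minkowski_sum C D)"
    if "polyhedral_cone C" "polyhedral_cone D" for C D
    using conv_aux_eq[of "{()}" "\<lambda>_. C" "{()}" "\<lambda>_. D" "indicator C" "\<lambda>_. 1" "indicator D" "\<lambda>_. 1"]
    by (simp add: p_def indicator_cone_span that)
  moreover have "conv_aux h (\<lambda>x. a * f x + b * g x) = (\<lambda>x. a * conv_aux h f x + b * conv_aux h g x)"
    if "f \<in> cone_span" "g \<in> cone_span" "h \<in> cone_span" for f g a b and h :: "real^'n \<Rightarrow> real"
    using conv_aux_linear[OF that, of a b] that by (simp add: conv_aux_commute cone_span_lincomb)
  ultimately have p: "is_convolution p"
    unfolding is_convolution_def
    by (simp add: p_def conv_aux_linear cone_span_lincomb conv_aux_in_cone_span)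
  show ?thesis
    unfolding convolution_def by (rule theI[of is_convolution, OF p]) (rule is_convolution_unique[OF _ p])
qed

lemma convolution_lincomb_left:
  "f \<in> cone_span \<Longrightarrow> g \<in> cone_span \<Longrightarrow> h \<in> cone_span \<Longrightarrow>
   (\<lambda>x. a * f x + b * g x) \<bullet>\<^sub>c h = (\<lambda>x. a * (f \<bullet>\<^sub>c h) x + b * (g \<bullet>\<^sub>c h) x)"
  using is_convolution_convolution unfolding is_convolution_def by blast

lemma convolution_lincomb_right:
  "f \<in> cone_span \<Longrightarrow> g \<in> cone_span \<Longrightarrow> h \<in> cone_span \<Longrightarrow>
   h \<bullet>\<^sub>c (\<lambda>x. a * f x + b * g x) = (\<lambda>x. a * (h \<bullet>\<^sub>c f) x + b * (h \<bullet>\<^sub>c g) x)"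
  using is_convolution_convolution unfolding is_convolution_def by blast

lemma convolution_indicator:
  "polyhedral_cone C \<Longrightarrow> polyhedral_cone D \<Longrightarrow>
   indicator C \<bullet>\<^sub>c indicator D = indicator (minkowski_sum C D)"
  using is_convolution_convolution unfolding is_convolution_def by blast

lemma convolution_zero:
  assumes "h \<in> cone_span"
  shows "(\<lambda>_. 0) \<bullet>\<^sub>c h = (\<lambda>_. 0)" "h \<bullet>\<^sub>c (\<lambda>_. 0) = (\<lambda>_. 0)"
  using convolution_lincomb_left[OF zero_cone_span zero_cone_span assms, of 0 0]
    convolution_lincomb_right[OF zero_cone_span zero_cone_span assms, of 0 0] by simp_all

section \<open>Ordered set partitions\<close>

lemma osp_Nil [simp]: "osp X [] \<longleftrightarrow> X = {}"
  by (auto simp: osp_def partition_on_def)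

lemma osp_Cons: "osp X (B # V) \<longleftrightarrow> B \<noteq> {} \<and> B \<subseteq> X \<and> osp (X - B) V"
proof
  assume "osp X (B # V)"
  then have *: "distinct V" "B \<notin> set V" "\<Union>(set V) \<union> B = X" "disjoint (insert B (set V))"
    "{} \<notin> set V" "B \<noteq> {}"
    by (auto simp: osp_def partition_on_def)
  have "B \<inter> C = {}" if "C \<in> set V" for C
    using *(2,4) that by (auto simp: disjoint_def)
  then show "B \<noteq> {} \<and> B \<subseteq> X \<and> osp (X - B) V"
    using * by (auto simp: osp_def partition_on_def disjoint_def)
next
  assume *: "B \<noteq> {} \<and> B \<subseteq> X \<and> osp (X - B) V"
  then have V: "\<Union>(set V) = X - B" by (auto simp: osp_def partition_on_def)
  then have "B \<notin> set V" using * by blast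
  then show "osp X (B # V)" using * V
    by (auto simp: osp_def partition_on_def disjoint_def)
qed

lemma osp_Union: "osp X V \<Longrightarrow> \<Union>(set V) = X"
  by (auto simp: osp_def partition_on_def)

lemma osp_distinct: "osp X V \<Longrightarrow> distinct V"
  by (auto simp: osp_def)

lemma osp_rotate: "osp X (rotate j V) \<longleftrightarrow> osp X V"
  by (simp add: osp_def)

lemma finite_osp: "finite {V. osp (X :: 'a::finite set) V}"
proof (rule finite_subset)
  have "length V \<le> CARD('a set)" if "osp X V" for V
    using that card_mono[of UNIV "set V"] by (simp add: osp_def distinct_card)
  then show "{V. osp X V} \<subseteq> {V. set V \<subseteq> UNIV \<and> length V \<le> CARD('a set)}"
    by blast
  show "finite {V. set V \<subseteq> (UNIV :: 'a set set) \<and> length V \<le> CARD('a set)}"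
    by (rule finite_lists_length_le) simp
qed

text \<open>An ordered set partition is handled as a weak order on elements, with strict part
  \<open>blk_lt\<close> and preorder \<open>blk_le\<close>. Subwords, restrictions and monotonicity
  of \<open>y\<close> become statements about these relations.\<close>

primrec blk_lt :: "'a set list \<Rightarrow> 'a \<Rightarrow> 'a \<Rightarrow> bool" where
  "blk_lt [] x z \<longleftrightarrow> False"
| "blk_lt (B # V) x z \<longleftrightarrow> x \<in> B \<and> z \<in> \<Union>(set V) \<or> blk_lt V x z"

primrec blk_le :: "'a set list \<Rightarrow> 'a \<Rightarrow> 'a \<Rightarrow> bool" where
  "blk_le [] x z \<longleftrightarrow> False"
| "blk_le (B # V) x z \<longleftrightarrow> x \<in> B \<and> z \<in> B \<union> \<Union>(set V) \<or> blk_le V x z"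

lemma blk_lt_mem: "blk_lt V x z \<Longrightarrow> x \<in> \<Union>(set V) \<and> z \<in> \<Union>(set V)"
  by (induction V) auto

lemma blk_le_mem: "blk_le V x z \<Longrightarrow> x \<in> \<Union>(set V) \<and> z \<in> \<Union>(set V)"
  by (induction V) auto

lemma blk_le_iff:
  "osp X V \<Longrightarrow> blk_le V x z \<longleftrightarrow> x \<in> X \<and> z \<in> X \<and> \<not> blk_lt V z x"
proof (induction V arbitrary: X)
  case (Cons B V)
  then have IH: "blk_le V x z \<longleftrightarrow> x \<in> X - B \<and> z \<in> X - B \<and> \<not> blk_lt V z x"
    using Cons.IH[of "X - B"] by (simp add: osp_Cons)
  have "\<Union>(set V) = X - B" "B \<subseteq> X" using Cons.prems by (auto simp: osp_Cons osp_Union)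
  then show ?case using IH blk_lt_mem[of V z x] by auto
qed auto

lemma blk_lt_irrefl: "osp X V \<Longrightarrow> \<not> blk_lt V x x"
proof (induction V arbitrary: X)
  case (Cons B V)
  then show ?case using osp_Union[of "X - B" V] blk_lt_mem[of V x x] by (auto simp: osp_Cons)
qed auto

lemma blk_lt_trans: "osp X V \<Longrightarrow> blk_lt V x y \<Longrightarrow> blk_lt V y z \<Longrightarrow> blk_lt V x z"
proof (induction V arbitrary: X)
  case (Cons B V)
  then have "\<Union>(set V) = X - B" "osp (X - B) V" by (auto simp: osp_Cons osp_Union)
  then show ?case using Cons.IH Cons.prems blk_lt_mem[of V] by auto
qed auto

lemma blk_lt_same_block:
  "osp X V \<Longrightarrow> B \<in> set V \<Longrightarrow> x \<in> B \<Longrightarrow> x' \<in> B \<Longrightarrow> blk_lt V z x \<longleftrightarrow> blk_lt V z x'"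
proof (induction V arbitrary: X)
  case (Cons C V)
  then have V: "\<Union>(set V) = X - C" "osp (X - C) V" by (auto simp: osp_Cons osp_Union)
  show ?case
  proof (cases "B \<in> set V")
    case True
    then have "x \<notin> C" "x' \<notin> C" "x \<in> \<Union>(set V)" "x' \<in> \<Union>(set V)" using V(1) Cons.prems by blast+
    then show ?thesis using Cons.IH[OF V(2) True] Cons.prems by auto
  next
    case False
    then have "x \<in> C" "x' \<in> C" using Cons.prems by auto
    then have "x \<notin> \<Union>(set V)" "x' \<notin> \<Union>(set V)" using V(1) by blast+
    then show ?thesis using blk_lt_mem[of V z x] blk_lt_mem[of V z x'] by auto
  qed
qed auto

text \<open>Preservation of the strict order makes \<open>B\<close> at least as fine as
  \<open>A\<close>, containment of blocks makes it at least as coarse. An element of the first block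
  of \<open>B\<close> has no predecessor, so it lies in the first block of \<open>A\<close>; and the
  block of \<open>B\<close> containing the latter can only be the first one.\<close>

lemma osp_eqI:
  "osp X A \<Longrightarrow> osp X B \<Longrightarrow> (\<And>x z. blk_lt A x z \<Longrightarrow> blk_lt B x z) \<Longrightarrow>
   (\<And>b. b \<in> set A \<Longrightarrow> \<exists>c\<in>set B. b \<subseteq> c) \<Longrightarrow> A = B"
proof (induction A arbitrary: X B)
  case Nil
  then show ?case by (cases B) (auto simp: osp_Cons)
next
  case (Cons a A)
  then obtain b B' where B: "B = b # B'" by (cases B) (auto simp: osp_Cons)
  have a: "a \<noteq> {}" "a \<subseteq> X" "osp (X - a) A" using Cons.prems(1) by (auto simp: osp_Cons)
  have b: "b \<noteq> {}" "b \<subseteq> X" "osp (X - b) B'" using Cons.prems(2) B by (auto simp: osp_Cons)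
  note UA = osp_Union[OF a(3)] and UB = osp_Union[OF b(3)]
  have not_lt: "\<not> blk_lt B x z" if "z \<in> b" for x z
    using that UB B blk_lt_mem[of B' x z] by auto
  have "b \<subseteq> a"
  proof
    fix z assume z: "z \<in> b"
    obtain x where "x \<in> a" using a by blast
    then have "blk_lt (a # A) x z" if "z \<notin> a" using that z b UA by auto
    then show "z \<in> a" using Cons.prems(3) not_lt[OF z] by blast
  qed
  moreover obtain c where "c \<in> set B" "a \<subseteq> c" using Cons.prems(4)[of a] by auto
  moreover have "c = b"
  proof (rule ccontr)
    assume "c \<noteq> b"
    then have "c \<subseteq> X - b" using \<open>c \<in> set B\<close> B UB by auto
    then show False using \<open>b \<subseteq> a\<close> \<open>a \<subseteq> c\<close> b(1) by blast
  qed
  ultimately have ab: "a = b" by blast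
  moreover have "A = B'"
  proof (rule Cons.IH[OF a(3)])
    show "osp (X - a) B'" using b(3) ab by simp
    show "blk_lt B' x z" if "blk_lt A x z" for x z
    proof -
      have "x \<in> X - a" using blk_lt_mem[OF that] UA by blast
      then show ?thesis using Cons.prems(3)[of x z] that B ab by auto
    qed
    show "\<exists>c\<in>set B'. d \<subseteq> c" if "d \<in> set A" for d
    proof -
      have "d \<subseteq> X - a" "d \<noteq> {}" using that UA a(3) by (auto simp: osp_def partition_on_def)
      then show ?thesis using Cons.prems(4)[of d] that B ab by auto
    qed
  qed
  ultimately show ?case using B by simp
qed

section \<open>Restrictions, subwords and monotonicity along blocks\<close>

definition restr :: "'a set \<Rightarrow> 'a set list \<Rightarrow> 'a set list" where
  "restr X V = filter (\<lambda>B. B \<noteq> {}) (map (\<lambda>B. B \<inter> X) V)"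

lemma subword_restr: "subword A V \<longleftrightarrow> restr (\<Union>(set A)) V = A"
  by (simp add: subword_def restr_def)

lemma restr_simps [simp]:
  "restr X [] = []"
  "restr X (B # V) = (if B \<inter> X = {} then restr X V else (B \<inter> X) # restr X V)"
  by (auto simp: restr_def)

lemma restr_append: "restr X (V @ W) = restr X V @ restr X W"
  by (simp add: restr_def)

lemma Union_restr: "\<Union>(set (restr X V)) = \<Union>(set V) \<inter> X"
  by (induction V) auto

lemma osp_restr: "osp Y V \<Longrightarrow> osp (Y \<inter> X) (restr X V)"
proof (induction V arbitrary: Y)
  case (Cons B V)
  then have "osp ((Y - B) \<inter> X) (restr X V)" "B \<subseteq> Y" by (auto simp: osp_Cons)
  moreover have "B \<inter> X = {} \<Longrightarrow> (Y - B) \<inter> X = Y \<inter> X" "(Y - B) \<inter> X = Y \<inter> X - B \<inter> X" by auto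
  ultimately show ?case by (auto simp: osp_Cons)
qed auto

lemma blk_lt_restr: "blk_lt (restr X V) x z \<longleftrightarrow> x \<in> X \<and> z \<in> X \<and> blk_lt V x z"
  by (induction V) (auto simp: Union_restr)

lemma blk_le_restr: "blk_le (restr X V) x z \<longleftrightarrow> x \<in> X \<and> z \<in> X \<and> blk_le V x z"
  by (induction V) (auto simp: Union_restr)

text \<open>Being a subword splits into two kinds of constraints on \<open>V\<close>: certain sets
  must not be cut, and certain pairs must be strictly ordered. In this form the conditions for
  several words can be imposed together, as in \<open>compatible\<close>.\<close>

lemma subword_iff:
  assumes "osp X A" "osp UNIV V"
  shows "subword A V \<longleftrightarrow> (\<forall>b\<in>set A. \<exists>B\<in>set V. b \<subseteq> B) \<and> (\<forall>x z. blk_lt A x z \<longrightarrow> blk_lt V x z)"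
proof
  assume "subword A V"
  then have r: "restr X V = A" using osp_Union[OF assms(1)] by (simp add: subword_restr)
  have "\<forall>b\<in>set (restr X V). \<exists>B\<in>set V. b \<subseteq> B" by (auto simp: restr_def)
  moreover have "\<forall>x z. blk_lt (restr X V) x z \<longrightarrow> blk_lt V x z" by (simp add: blk_lt_restr)
  ultimately show "(\<forall>b\<in>set A. \<exists>B\<in>set V. b \<subseteq> B) \<and> (\<forall>x z. blk_lt A x z \<longrightarrow> blk_lt V x z)"
    using r by simp
next
  assume *: "(\<forall>b\<in>set A. \<exists>B\<in>set V. b \<subseteq> B) \<and> (\<forall>x z. blk_lt A x z \<longrightarrow> blk_lt V x z)"
  have "A = restr X V"
  proof (rule osp_eqI[OF assms(1)])
    show "osp X (restr X V)" using osp_restr[OF assms(2)] by simp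
    show "blk_lt (restr X V) x z" if "blk_lt A x z" for x z
      using that * blk_lt_mem[OF that] osp_Union[OF assms(1)] by (auto simp: blk_lt_restr)
    show "\<exists>c\<in>set (restr X V). b \<subseteq> c" if b: "b \<in> set A" for b
    proof -
      obtain B where "B \<in> set V" "b \<subseteq> B" using bspec[OF conjunct1[OF *] b] by blast
      moreover have "b \<subseteq> X" "b \<noteq> {}" using b assms(1) by (auto simp: osp_def partition_on_def)
      ultimately have "B \<inter> X \<in> set (restr X V)" "b \<subseteq> B \<inter> X" by (auto simp: restr_def)
      then show ?thesis by blast
    qed
  qed
  then show "subword A V" using osp_Union[OF assms(1)] by (simp add: subword_restr)
qed

text \<open>Elements of one block are related by \<open>blk_le\<close> in both directions, so this
  makes \<open>y\<close> constant on each block.\<close>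

definition decr :: "('a \<Rightarrow> real) \<Rightarrow> 'a set list \<Rightarrow> bool" where
  "decr y V \<longleftrightarrow> (\<forall>x z. blk_le V x z \<longrightarrow> y z \<le> y x)"

text \<open>By totality of the preorder, monotonicity of \<open>y\<close> is again a strict order
  constraint on \<open>V\<close>, with ties of \<open>y\<close> left free.\<close>

lemma decr_iff:
  "osp X V \<Longrightarrow> decr y V \<longleftrightarrow> (\<forall>x\<in>X. \<forall>z\<in>X. y z < y x \<longrightarrow> blk_lt V x z)"
  unfolding decr_def by (auto simp: blk_le_iff not_le[symmetric])

lemma decr_restr: "decr y V \<Longrightarrow> decr y (restr X V)"
  by (auto simp: decr_def blk_le_restr)

section \<open>Signed count of partitions compatible with an order\<close>

definition compatible :: "'a set set \<Rightarrow> ('a \<Rightarrow> 'a \<Rightarrow> bool) \<Rightarrow> 'a set list \<Rightarrow> bool" where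
  "compatible N R V \<longleftrightarrow> osp (\<Union>N) V \<and> (\<forall>b\<in>N. \<exists>B\<in>set V. b \<subseteq> B) \<and>
     (\<forall>w\<in>\<Union>N. \<forall>x\<in>\<Union>N. R w x \<longrightarrow> blk_lt V w x)"

text \<open>Ensures that different selections of members merge into different first blocks, so that
  the decomposition by first blocks is a disjoint union.\<close>

lemma Union_inj_disjoint:
  assumes "disjoint N" "{} \<notin> N" "P \<subseteq> N" "Q \<subseteq> N" "\<Union>P = \<Union>Q"
  shows "P = Q"
proof -
  have "P \<subseteq> Q" if PQ: "P \<subseteq> N" "Q \<subseteq> N" "\<Union>P = \<Union>Q" for P Q
  proof
    fix b assume b: "b \<in> P"
    then obtain x where x: "x \<in> b" using assms(2) PQ(1) by (cases "b = {}") auto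
    then obtain c where "c \<in> Q" "x \<in> c" using b PQ(3) by blast
    then have "b = c" using disjointD[OF assms(1), of b c] x b PQ by blast
    then show "b \<in> Q" using \<open>c \<in> Q\<close> by simp
  qed
  from this[of P Q] this[of Q P] show ?thesis using assms(3-5) by simp
qed

text \<open>The members of \<open>M\<close> have no predecessor under \<open>R\<close>, in
  particular none among each other, so any nonempty selection \<open>P\<close> of them can be merged
  into a first block. Conversely, the first block of a compatible \<open>V\<close> is a union of
  members, as none is cut, and a predecessor of one of its elements would need an earlier
  block.\<close>

lemma compatible_decompose:
  fixes N :: "'a set set" and R :: "'a \<Rightarrow> 'a \<Rightarrow> bool"
  assumes N: "disjoint N" "{} \<notin> N" "N \<noteq> {}"
  defines "M \<equiv> {b\<in>N. \<forall>x\<in>b. \<forall>w\<in>\<Union>N. \<not> R w x}"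
  shows "{V. compatible N R V} = (\<Union>P\<in>Pow M - {{}}. (#) (\<Union>P) ` {V. compatible (N - P) R V})"
proof (intro equalityI subsetI)
  fix V assume "V \<in> {V. compatible N R V}"
  then have V: "osp (\<Union>N) V" "\<forall>b\<in>N. \<exists>B\<in>set V. b \<subseteq> B"
    "\<And>w x. w\<in>\<Union>N \<Longrightarrow> x\<in>\<Union>N \<Longrightarrow> R w x \<Longrightarrow> blk_lt V w x" by (auto simp: compatible_def)
  obtain b0 where "b0 \<in> N" "b0 \<noteq> {}" using N(2,3) by (metis ex_in_conv)
  then have "\<Union>N \<noteq> {}" by blast
  then obtain B W where BW: "V = B # W" using V(1) by (cases V) auto
  have B: "B \<noteq> {}" "B \<subseteq> \<Union>N" "osp (\<Union>N - B) W" using V(1) BW by (auto simp: osp_Cons)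
  note UW = osp_Union[OF B(3)]
  define P where "P = {b\<in>N. b \<subseteq> B}"
  have other: "b \<subseteq> \<Union>N - B" if b: "b \<in> N" "b \<notin> P" for b
  proof -
    obtain C where "C \<in> set V" "b \<subseteq> C" using V(2) b by blast
    then show ?thesis using b BW UW by (auto simp: P_def)
  qed
  have "x \<in> \<Union>P" if "x \<in> B" for x
    using that B(2) other by blast
  then have BP: "B = \<Union>P" by (auto simp: P_def)
  have UNP: "\<Union>N - B = \<Union>(N - P)" using other by (auto simp: P_def)
  have "P \<subseteq> M"
  proof
    fix b assume b: "b \<in> P"
    have "\<not> R w x" if "x \<in> b" "w \<in> \<Union>N" for x w
    proof
      assume "R w x"
      then have "blk_lt V w x" using V(3)[of w x] that b by (auto simp: P_def)
      moreover have "x \<in> B" using that b BP by blast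
      ultimately show False using BW UW blk_lt_mem[of W w x] by auto
    qed
    then show "b \<in> M" using b by (auto simp: M_def P_def)
  qed
  moreover have "P \<noteq> {}" using B(1) BP by auto
  moreover have "compatible (N - P) R W"
    unfolding compatible_def
  proof (intro conjI ballI impI)
    show "osp (\<Union>(N - P)) W" using B(3) UNP by simp
    show "\<exists>C\<in>set W. b \<subseteq> C" if b: "b \<in> N - P" for b
    proof -
      obtain C where "C \<in> set V" "b \<subseteq> C" using V(2) b by blast
      then show ?thesis using b BW by (auto simp: P_def)
    qed
    show "blk_lt W w x" if "w \<in> \<Union>(N - P)" "x \<in> \<Union>(N - P)" "R w x" for w x
    proof -
      have "w \<notin> B" using that(1) UNP by blast
      moreover have "blk_lt V w x" using V(3)[of w x] that by blast
      ultimately show ?thesis using BW by simp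
    qed
  qed
  ultimately show "V \<in> (\<Union>P\<in>Pow M - {{}}. (#) (\<Union>P) ` {V. compatible (N - P) R V})"
    using BW BP by auto
next
  fix V assume "V \<in> (\<Union>P\<in>Pow M - {{}}. (#) (\<Union>P) ` {V. compatible (N - P) R V})"
  then obtain P W where P: "P \<subseteq> M" "P \<noteq> {}" "V = \<Union>P # W" "compatible (N - P) R W" by auto
  have PN: "P \<subseteq> N" using P(1) by (auto simp: M_def)
  have U: "\<Union>(N - P) = \<Union>N - \<Union>P"
  proof -
    have False if "x \<in> b" "b \<in> N - P" "x \<in> c" "c \<in> P" for x b c
      using that PN disjointD[OF N(1), of b c] by blast
    then show ?thesis by blast
  qed
  have W: "osp (\<Union>N - \<Union>P) W" "\<forall>b\<in>N-P. \<exists>B\<in>set W. b \<subseteq> B"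
    "\<And>w x. w\<in>\<Union>N-\<Union>P \<Longrightarrow> x\<in>\<Union>N-\<Union>P \<Longrightarrow> R w x \<Longrightarrow> blk_lt W w x"
    using P(4) unfolding compatible_def U by auto
  obtain b0 where "b0 \<in> P" "b0 \<noteq> {}" using P(2) PN N(2) by (metis ex_in_conv subsetD)
  then have "\<Union>P \<noteq> {}" by blast
  then have "osp (\<Union>N) V" using P(3) W(1) PN by (auto simp: osp_Cons)
  moreover have "\<exists>B\<in>set V. b \<subseteq> B" if "b \<in> N" for b
    using W(2) that P(3) by (cases "b \<in> P") auto
  moreover have "blk_lt V w x" if "w \<in> \<Union>N" "x \<in> \<Union>N" "R w x" for w x
  proof -
    have "x \<notin> \<Union>P" using that P(1) by (auto simp: M_def)
    then show ?thesis using W(3)[of w x] that P(3) osp_Union[OF W(1)] by auto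
  qed
  ultimately show "V \<in> {V. compatible N R V}" unfolding compatible_def by blast
qed

lemma sum_Pow_alternating:
  assumes "finite M" "M \<noteq> {}"
  shows "(\<Sum>P\<in>Pow M. (-1::real) ^ card P) = 0"
  using assms
proof (induction M rule: finite_ne_induct)
  case (insert x M)
  have "(\<Sum>P\<in>Pow (insert x M). (-1::real) ^ card P) =
    (\<Sum>P\<in>Pow M. (-1) ^ card P) + (\<Sum>P\<in>insert x ` Pow M. (-1) ^ card P)"
    unfolding Pow_insert using insert by (intro sum.union_disjoint) auto
  also have "(\<Sum>P\<in>insert x ` Pow M. (-1::real) ^ card P) = (\<Sum>P\<in>Pow M. (-1) ^ card (insert x P))"
    using insert by (intro sum.reindex_cong[of "insert x"]) (auto simp: inj_on_def)
  also have "\<dots> = (\<Sum>P\<in>Pow M. - ((-1) ^ card P))"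
  proof (rule sum.cong[OF refl])
    fix P assume "P \<in> Pow M"
    then have "finite P" "x \<notin> P" using insert by (auto intro: finite_subset)
    then show "(-1::real) ^ card (insert x P) = - ((-1) ^ card P)" by simp
  qed
  finally show ?case by (simp add: sum_negf)
qed (simp add: Pow_insert)

text \<open>Acyclicity of \<open>R\<close> is stated as existence of a minimal member in every
  nonempty subfamily, a form that passes to \<open>N - P\<close>. Splitting off the first block
  costs a factor -1 and leaves the sign of \<open>N - P\<close>. Since the alternating sum over all
  subsets of \<open>M\<close> vanishes, the nonempty ones contribute -1, and the two signs
  cancel.\<close>

lemma sum_compatible:
  fixes N :: "'a::finite set set"
  assumes "disjoint N" "{} \<notin> N"
    and "\<And>N'. N' \<subseteq> N \<Longrightarrow> N' \<noteq> {} \<Longrightarrow> \<exists>b\<in>N'. \<forall>x\<in>b. \<forall>w\<in>\<Union>N'. \<not> R w x"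
  shows "(\<Sum>V | compatible N R V. (-1::real) ^ length V) = (-1) ^ card N"
proof -
  have "finite N" by simp
  then show ?thesis using assms
  proof (induction N rule: finite_psubset_induct)
    case (psubset N)
    show ?case
    proof (cases "N = {}")
      case True
      then have "{V. compatible N R V} = {[]}"
        by (auto simp: compatible_def) (metis Union_empty equals0D list.set_intros(1) neq_Nil_conv osp_Cons subset_empty)
      then show ?thesis using True by simp
    next
      case False
      define M where "M = {b\<in>N. \<forall>x\<in>b. \<forall>w\<in>\<Union>N. \<not> R w x}"
      have "M \<noteq> {}" using psubset.prems(3)[OF order_refl False] by (auto simp: M_def)
      have MN: "M \<subseteq> N" by (auto simp: M_def)
      have fin: "finite {V. compatible P R V}" for P
        using finite_osp[of "\<Union>P"] by (rule rev_finite_subset) (auto simp: compatible_def)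
      have "(\<Sum>V | compatible N R V. (-1::real) ^ length V) =
        (\<Sum>P\<in>Pow M - {{}}. \<Sum>V\<in>(#) (\<Union>P) ` {V. compatible (N - P) R V}. (-1) ^ length V)"
        unfolding compatible_decompose[OF psubset.prems(1,2) False] M_def[symmetric]
      proof (rule sum.UNION_disjoint)
        have "\<Union>P \<noteq> \<Union>Q" if "P \<in> Pow M - {{}}" "Q \<in> Pow M - {{}}" "P \<noteq> Q" for P Q
          using Union_inj_disjoint[OF psubset.prems(1,2), of P Q] MN that by blast
        then have disj: "(#) (\<Union>P) ` {V. compatible (N - P) R V} \<inter> (#) (\<Union>Q) ` {V. compatible (N - Q) R V} = {}"
          if "P \<in> Pow M - {{}}" "Q \<in> Pow M - {{}}" "P \<noteq> Q" for P Q
          using that by blast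
        show "\<forall>P\<in>Pow M - {{}}. \<forall>Q\<in>Pow M - {{}}. P \<noteq> Q \<longrightarrow>
          (#) (\<Union>P) ` {V. compatible (N - P) R V} \<inter> (#) (\<Union>Q) ` {V. compatible (N - Q) R V} = {}"
          by (intro ballI impI disj)
      qed (auto simp: fin)
      also have "\<dots> = (\<Sum>P\<in>Pow M - {{}}. - ((-1) ^ card N * (-1) ^ card P))"
      proof (rule sum.cong[OF refl])
        fix P assume P: "P \<in> Pow M - {{}}"
        then have PN: "P \<subseteq> N" "P \<noteq> {}" using MN by auto
        have "(\<Sum>V\<in>(#) (\<Union>P) ` {V. compatible (N - P) R V}. (-1::real) ^ length V) =
          (\<Sum>V | compatible (N - P) R V. - ((-1) ^ length V))"
          by (subst sum.reindex) (auto simp: inj_on_def)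
        also have "\<dots> = - (\<Sum>V | compatible (N - P) R V. (-1) ^ length V)" by (rule sum_negf)
        also have "(\<Sum>V | compatible (N - P) R V. (-1::real) ^ length V) = (-1) ^ card (N - P)"
        proof (rule psubset.IH)
          show "N - P \<subset> N" using PN by blast
          show "disjoint (N - P)" using psubset.prems(1) by (auto simp: disjoint_def)
          show "{} \<notin> N - P" using psubset.prems(2) by blast
          show "\<exists>b\<in>N'. \<forall>x\<in>b. \<forall>w\<in>\<Union>N'. \<not> R w x" if "N' \<subseteq> N - P" "N' \<noteq> {}" for N'
            using that psubset.prems(3)[of N'] by blast
        qed
        also have "(-1::real) ^ card (N - P) = (-1) ^ card N * (-1) ^ card P"
        proof -
          have "card N = card (N - P) + card P"
            using PN card_mono[of N P] by (simp add: card_Diff_subset)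
          then show ?thesis by (simp add: power_add mult.assoc flip: power_mult_distrib)
        qed
        finally show "(\<Sum>V\<in>(#) (\<Union>P) ` {V. compatible (N - P) R V}. (-1::real) ^ length V) =
          - ((-1) ^ card N * (-1) ^ card P)" .
      qed
      also have "\<dots> = - ((-1) ^ card N) * (\<Sum>P\<in>Pow M - {{}}. (-1) ^ card P)"
        by (simp add: sum_distrib_left)
      also have "(\<Sum>P\<in>Pow M - {{}}. (-1::real) ^ card P) = -1"
        using sum_Pow_alternating[OF _ \<open>M \<noteq> {}\<close>] by (simp add: sum_diff1)
      finally show ?thesis by simp
    qed
  qed
qed

section \<open>Rotations and common refinements\<close>

lemma rotate_mod_less:
  assumes "L \<noteq> []"
  obtains k where "k < length L" "rotate j L = rotate k L"
  using assms rotate_conv_mod[of j L] by (metis length_greater_0_conv mod_less_divisor)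

lemma rotate_inverse: obtains r where "rotate r (rotate j L) = L"
proof (cases "L = []")
  case False
  \<comment> \<open>A multiple of the length that is at least \<open>j\<close>, so that the
    subtraction of naturals below does not truncate.\<close>
  then have "j \<le> j * length L" by (cases L) auto
  then have "rotate (j * length L - j) (rotate j L) = rotate (j * length L) L"
    by (simp add: rotate_rotate)
  also have "\<dots> = L" using rotate_conv_mod[of "j * length L" L] by simp
  finally show ?thesis using that by blast
qed (use that in auto)

lemma restr_rotate: obtains j' where "restr X (rotate j V) = rotate j' (restr X V)"
proof -
  let ?k = "j mod length V"
  have "restr X (rotate j V) = restr X (drop ?k V) @ restr X (take ?k V)"
    by (simp add: rotate_drop_take restr_append)
  also have "\<dots> = rotate (length (restr X (take ?k V))) (restr X (take ?k V) @ restr X (drop ?k V))"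
    by (simp add: rotate_append)
  also have "restr X (take ?k V) @ restr X (drop ?k V) = restr X V"
    by (metis append_take_drop_id restr_append)
  finally show ?thesis using that by blast
qed

text \<open>One step on the restriction may take several steps on \<open>W\<close>: the rotation
  must go past the first block that meets \<open>X\<close>, and the blocks before it leave no
  trace.\<close>

lemma rotate1_restr: "\<exists>i. rotate1 (restr X W) = restr X (rotate i W)"
proof (cases "\<exists>B\<in>set W. B \<inter> X \<noteq> {}")
  case True
  then obtain W1 B W2 where W: "W = W1 @ B # W2" "B \<inter> X \<noteq> {}" "\<forall>C\<in>set W1. \<not> C \<inter> X \<noteq> {}"
    using split_list_first_prop[OF True] by blast
  have W1: "restr X W1 = []" using W(3) by (auto simp: restr_def filter_empty_conv)
  have "rotate (length (W1 @ [B])) ((W1 @ [B]) @ W2) = W2 @ W1 @ [B]"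
    by (subst rotate_append) simp
  then have "restr X (rotate (length (W1 @ [B])) W) = rotate1 (restr X W)"
    using W(1,2) W1 by (simp add: restr_append)
  then show ?thesis by metis
next
  case False
  then have "restr X W = []" by (auto simp: restr_def filter_empty_conv)
  then show ?thesis by (intro exI[of _ 0]) simp
qed

lemma rotate_restr: "\<exists>i. rotate j (restr X W) = restr X (rotate i W)"
proof (induction j)
  case 0
  show ?case by (rule exI[of _ 0]) simp
next
  case (Suc j)
  then obtain i where "rotate j (restr X W) = restr X (rotate i W)" by blast
  moreover obtain k where "rotate1 (restr X (rotate i W)) = restr X (rotate k (rotate i W))"
    using rotate1_restr by blast
  ultimately show ?case by (auto simp: rotate_rotate)
qed

text \<open>Moves the freedom of rotation from \<open>L\<close> to the word \<open>A\<close>. As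
  \<open>q\<close> is arbitrary, the condition on \<open>L\<close> can be tested on any rotation of
  it, which then contains some rotation of \<open>A\<close> linearly.\<close>

lemma cyclic_subword_rotate:
  assumes "A \<noteq> []" "L \<noteq> []"
  shows "(\<exists>j<length L. subword A (rotate j L)) \<longleftrightarrow> (\<exists>j<length A. subword (rotate j A) (rotate q L))"
proof
  let ?X = "\<Union>(set A)"
  assume "\<exists>j<length L. subword A (rotate j L)"
  then obtain j where j: "restr ?X (rotate j L) = A" by (auto simp: subword_restr)
  obtain r where "rotate r (rotate j L) = L" by (rule rotate_inverse)
  then have "rotate q L = rotate (q + r) (rotate j L)" by (metis rotate_rotate)
  then obtain j' where "restr ?X (rotate q L) = rotate j' A" using restr_rotate j by metis
  moreover obtain k where "k < length A" "rotate j' A = rotate k A" using rotate_mod_less[OF assms(1)] .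
  ultimately show "\<exists>j<length A. subword (rotate j A) (rotate q L)" by (auto simp: subword_restr)
next
  let ?X = "\<Union>(set A)"
  assume "\<exists>j<length A. subword (rotate j A) (rotate q L)"
  then obtain j where j: "restr ?X (rotate q L) = rotate j A" by (auto simp: subword_restr)
  obtain r where "rotate r (rotate j A) = A" by (rule rotate_inverse)
  then obtain i where "A = restr ?X (rotate i (rotate q L))" using rotate_restr j by metis
  moreover obtain k where "k < length L" "rotate (i + q) L = rotate k L" using rotate_mod_less[OF assms(2)] .
  ultimately show "\<exists>j<length L. subword A (rotate j L)" by (auto simp: subword_restr rotate_rotate)
qed

lemma rotate_distinct_inj:
  assumes "distinct L" "i < length L" "j < length L" "rotate i L = rotate j L"
  shows "i = j"
proof -
  have "L ! i = L ! j"
    using assms nth_rotate[of 0 L i] nth_rotate[of 0 L j] by force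
  then show ?thesis using assms by (simp add: nth_eq_iff_index_eq)
qed

text \<open>Every ordered set partition has exactly one rotation whose first block contains the
  minimum, so pairs of a standard partition and a rotation index biject with all ordered set
  partitions.\<close>

lemma sum_standard_osp_rotate:
  fixes g :: "'n::{finite,linorder} set list \<Rightarrow> real"
  assumes P: "\<And>L j. L \<noteq> [] \<Longrightarrow> P (rotate j L) \<longleftrightarrow> P L"
  shows "(\<Sum>L | standard_osp UNIV L \<and> P L. \<Sum>j<length L. g (rotate j L)) =
         (\<Sum>V | osp UNIV V \<and> P V. g V)"
proof -
  let ?S = "{L. standard_osp (UNIV :: 'n set) L \<and> P L}"
  let ?m = "Min (UNIV :: 'n set)"
  have fin: "finite ?S"
    using finite_osp[of UNIV] by (rule rev_finite_subset) (auto simp: standard_osp_def)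
  have nonempty: "V \<noteq> []" if "osp (UNIV :: 'n set) V" for V using that by auto
  have inj: "inj_on (\<lambda>(L, j). rotate j L) (Sigma ?S (\<lambda>L. {..<length L}))"
  proof (rule inj_onI)
    fix p q assume pq: "p \<in> Sigma ?S (\<lambda>L. {..<length L})" "q \<in> Sigma ?S (\<lambda>L. {..<length L})"
      "(case p of (L, j) \<Rightarrow> rotate j L) = (case q of (L, j) \<Rightarrow> rotate j L)"
    obtain L j L' j' where p: "p = (L, j)" "q = (L', j')" by (cases p; cases q)
    have *: "standard_osp UNIV L" "j < length L" "standard_osp UNIV L'" "j' < length L'"
      "rotate j L = rotate j' L'" using pq by (auto simp: p)
    then have osp: "osp UNIV L" "osp UNIV L'" "?m \<in> hd L" "?m \<in> hd L'" by (auto simp: standard_osp_def)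
    note ne = nonempty[OF osp(1)]
    obtain r where "rotate r (rotate j' L') = L'" by (rule rotate_inverse)
    then have "L' = rotate (r + j) L" using *(5) by (metis rotate_rotate)
    then obtain k where k: "k < length L" "L' = rotate k L" using rotate_mod_less[OF ne] by metis
    have "?m \<in> L ! k" using osp(4) k hd_rotate_conv_nth[OF ne, of k] by simp
    moreover have "?m \<in> L ! 0" using osp(3) ne by (simp add: hd_conv_nth)
    ultimately have "L ! k = L ! 0"
      using osp(1) disjointD[of "set L" "L ! k" "L ! 0"] k(1) nth_mem[of k L] nth_mem[of 0 L] ne
      unfolding osp_def partition_on_def by blast
    then have "k = 0" using osp_distinct[OF osp(1)] k(1) ne by (simp add: nth_eq_iff_index_eq)
    then have "L = L'" using k(2) by simp
    then show "p = q"
      using rotate_distinct_inj[OF osp_distinct[OF osp(1)], of j j'] * by (simp add: p)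
  qed
  have img: "(\<lambda>(L, j). rotate j L) ` (Sigma ?S (\<lambda>L. {..<length L})) = {V. osp UNIV V \<and> P V}"
  proof (intro equalityI subsetI)
    fix V assume "V \<in> (\<lambda>(L, j). rotate j L) ` (Sigma ?S (\<lambda>L. {..<length L}))"
    then show "V \<in> {V. osp UNIV V \<and> P V}"
      using nonempty by (auto simp: standard_osp_def osp_rotate P)
  next
    fix V assume "V \<in> {V. osp UNIV V \<and> P V}"
    then have V: "osp UNIV V" "P V" by auto
    have "?m \<in> \<Union>(set V)" unfolding osp_Union[OF V(1)] by simp
    then obtain B where "B \<in> set V" "?m \<in> B" by blast
    then obtain i where i: "i < length V" "?m \<in> V ! i" by (metis in_set_conv_nth)
    have "V \<noteq> []" using i by auto
    then have L: "standard_osp UNIV (rotate i V)" "P (rotate i V)"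
      using V i P hd_rotate_conv_nth[of V i] by (simp_all add: standard_osp_def osp_rotate)
    obtain r where "rotate r (rotate i V) = V" by (rule rotate_inverse)
    moreover obtain k where "k < length (rotate i V)" "rotate r (rotate i V) = rotate k (rotate i V)"
      using rotate_mod_less[of "rotate i V"] \<open>V \<noteq> []\<close> by auto
    ultimately have "V = (\<lambda>(L, j). rotate j L) (rotate i V, k)"
      "(rotate i V, k) \<in> Sigma ?S (\<lambda>L. {..<length L})" using L by auto
    then show "V \<in> (\<lambda>(L, j). rotate j L) ` (Sigma ?S (\<lambda>L. {..<length L}))" by blast
  qed
  have "(\<Sum>L\<in>?S. \<Sum>j<length L. g (rotate j L)) =
    (\<Sum>(L, j)\<in>Sigma ?S (\<lambda>L. {..<length L}). g (rotate j L))"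
    using fin by (subst sum.Sigma) auto
  also have "\<dots> = (\<Sum>p\<in>Sigma ?S (\<lambda>L. {..<length L}). g ((\<lambda>(L, j). rotate j L) p))"
    by (simp add: split_def)
  also have "\<dots> = (\<Sum>V | osp UNIV V \<and> P V. g V)"
    using inj img by (intro sum.reindex_bij_betw) (simp add: bij_betw_def)
  finally show ?thesis .
qed

section \<open>The signed count for linear words and for cyclic words\<close>

lemma finite_ex_max:
  fixes f :: "'a \<Rightarrow> 'b::linorder"
  assumes "finite X" "X \<noteq> {}"
  obtains x where "x \<in> X" "\<And>w. w \<in> X \<Longrightarrow> f w \<le> f x"
proof -
  have "Max (f ` X) \<in> f ` X" using assms by (intro Max_in) auto
  then obtain x where "x \<in> X" "f x = Max (f ` X)" by auto
  then show ?thesis using that[of x] assms by simp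
qed

text \<open>\<open>T\<close> may stand anywhere in each word, which is the situation after rotating.
  If \<open>y\<close> fails to decrease along some \<open>A i\<close>, it fails along every
  \<open>V\<close> with subword \<open>A i\<close>, and both sides vanish. Otherwise the admissible
  \<open>V\<close> are those compatible with the blocks in \<open>N\<close> and the relation
  \<open>R\<close>, and the work lies in finding minimal blocks for \<open>R\<close>.\<close>

lemma signed_sum_common_refinements:
  fixes A :: "'i \<Rightarrow> 'n::finite set list" and y :: "'n \<Rightarrow> real"
  assumes A: "\<And>i. i \<in> I \<Longrightarrow> osp (T \<union> U i) (A i)"
    and TA: "\<And>i. i \<in> I \<Longrightarrow> T \<noteq> {} \<Longrightarrow> T \<in> set (A i)"
    and U: "disjoint_family_on U I"
    and cover: "(\<Union>i\<in>I. T \<union> U i) = UNIV"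
  defines "N \<equiv> \<Union>i\<in>I. set (A i)"
  shows "(\<Sum>V | osp UNIV V \<and> decr y V \<and> (\<forall>i\<in>I. subword (A i) V). (-1) ^ length V) =
    (-1) ^ card N * (of_bool (\<forall>i\<in>I. decr y (A i)) :: real)"
proof (cases "\<forall>i\<in>I. decr y (A i)")
  case False
  have "decr y (A i)" if "decr y V" "subword (A i) V" for i V
    using that decr_restr[of y V] unfolding subword_restr by metis
  then have "{V. osp UNIV V \<and> decr y V \<and> (\<forall>i\<in>I. subword (A i) V)} = {}" using False by blast
  then show ?thesis using False by (simp only: sum.empty) simp
next
  case True
  define R where "R w x \<longleftrightarrow> y x < y w \<or> (\<exists>i\<in>I. blk_lt (A i) w x)" for w x
  have UA: "\<Union>(set (A i)) = T \<union> U i" if "i \<in> I" for i using osp_Union A that by blast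
  have "\<Union>N = (\<Union>i\<in>I. \<Union>(set (A i)))" by (auto simp: N_def)
  also have "\<dots> = UNIV" using UA cover by (simp cong: SUP_cong)
  finally have UN: "\<Union>N = UNIV" .
  have common: "x \<in> T" if "i \<in> I" "j \<in> I" "i \<noteq> j" "x \<in> T \<union> U i" "x \<in> T \<union> U j" for i j x
    using that disjoint_family_onD[OF U, of i j] by blast
  have same: "b = c" if "i \<in> I" "b \<in> set (A i)" "c \<in> set (A i)" "x \<in> b" "x \<in> c" for i b c x
    using A[OF that(1)] disjointD[of "set (A i)" b c] that unfolding osp_def partition_on_def by blast
  have disj: "disjoint N"
  proof (rule disjointI)
    fix b c assume bc: "b \<in> N" "c \<in> N" "b \<noteq> c"
    then obtain i j where ij: "i \<in> I" "b \<in> set (A i)" "j \<in> I" "c \<in> set (A j)" by (auto simp: N_def)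
    show "b \<inter> c = {}"
    proof (rule ccontr)
      assume "b \<inter> c \<noteq> {}"
      then obtain x where x: "x \<in> b" "x \<in> c" by blast
      show False
      proof (cases "i = j")
        case True
        then show ?thesis using same[of i b c x] ij x bc by blast
      next
        case False
        have "x \<in> T" using common[OF ij(1,3) False, of x] UA ij x by blast
        then show ?thesis
          using same[of i b T x] same[of j c T x] TA[of i] TA[of j] ij x bc by blast
      qed
    qed
  qed
  have ne: "{} \<notin> N" using A by (auto simp: N_def osp_def partition_on_def)
  txt \<open>Counting positions relative to the common block \<open>T\<close> gives one rank function \<open>\<rho>\<close> that increases
    along every \<open>A i\<close>; together with \<open>y\<close> it shows that \<open>R\<close> has minimal blocks.\<close>
  define cnt where "cnt i x = int (card {z. blk_lt (A i) z x})" for i x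
  \<comment> \<open>Integers are used because blocks before \<open>T\<close> get negative values.
    With \<open>T\<close> empty no element lies in two words, so no alignment is made.\<close>
  define r where "r i x = cnt i x - (if T = {} then 0 else cnt i (SOME \<tau>. \<tau> \<in> T))" for i x
  define \<rho> where "\<rho> x = r (SOME i. i \<in> I \<and> x \<in> T \<union> U i) x" for x
  have cnt_block: "cnt i x = cnt i x'" if "i \<in> I" "b \<in> set (A i)" "x \<in> b" "x' \<in> b" for i b x x'
    using blk_lt_same_block[OF A[OF that(1)] that(2-4)] by (simp add: cnt_def)
  have r_T: "r i x = 0" if "i \<in> I" "x \<in> T" for i x
  proof -
    have "(SOME \<tau>. \<tau> \<in> T) \<in> T" using that(2) by (rule someI)
    then show ?thesis using cnt_block[OF that(1) TA[OF that(1)], of x] that by (auto simp: r_def)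
  qed
  \<comment> \<open>The word chosen for \<open>x\<close> is immaterial: two words overlap only in
    \<open>T\<close>, where all aligned counts are 0.\<close>
  have \<rho>_eq: "\<rho> x = r i x" if "i \<in> I" "x \<in> T \<union> U i" for i x
  proof -
    define j where "j = (SOME i. i \<in> I \<and> x \<in> T \<union> U i)"
    have j: "j \<in> I" "x \<in> T \<union> U j" using someI[of "\<lambda>i. i \<in> I \<and> x \<in> T \<union> U i"] that unfolding j_def by blast+
    have "r j x = r i x" using common[of i j x] r_T that j by (cases "i = j") auto
    then show ?thesis by (simp add: \<rho>_def j_def)
  qed
  have \<rho>_block: "\<rho> x = \<rho> x'" if b: "b \<in> N" "x \<in> b" "x' \<in> b" for b x x'
  proof -
    obtain i where i: "i \<in> I" "b \<in> set (A i)" using b(1) by (auto simp: N_def)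
    then have "x \<in> T \<union> U i" "x' \<in> T \<union> U i" using UA b(2,3) by blast+
    then show ?thesis using cnt_block[OF i b(2,3)] by (simp add: \<rho>_eq[OF i(1)] r_def)
  qed
  have y_block: "y x = y x'" if b: "b \<in> N" "x \<in> b" "x' \<in> b" for b x x'
  proof -
    obtain i where i: "i \<in> I" "b \<in> set (A i)" using b(1) by (auto simp: N_def)
    have *: "blk_le (A i) u v" if "u \<in> b" "v \<in> b" for u v
      using blk_lt_same_block[OF A[OF i(1)] i(2) that(2,1), of v] blk_lt_irrefl[OF A[OF i(1)], of v] that UA[OF i(1)] i(2)
      unfolding blk_le_iff[OF A[OF i(1)]] by blast
    then show ?thesis using True i(1) b(2,3) unfolding decr_def by (meson order_antisym)
  qed
  have \<rho>_less: "\<rho> w < \<rho> x" if i: "i \<in> I" and lt: "blk_lt (A i) w x" for i w x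
  proof -
    have "{z. blk_lt (A i) z w} \<subset> {z. blk_lt (A i) z x}"
      using blk_lt_trans[OF A[OF i] _ lt] blk_lt_irrefl[OF A[OF i], of w] lt by blast
    then have "cnt i w < cnt i x" unfolding cnt_def by (simp add: psubset_card_mono)
    then show ?thesis using blk_lt_mem[OF lt] \<rho>_eq[OF i] unfolding UA[OF i] by (simp add: r_def)
  qed
  have y_le: "y x \<le> y w" if i: "i \<in> I" and lt: "blk_lt (A i) w x" for i w x
  proof -
    have "blk_le (A i) w x"
      unfolding blk_le_iff[OF A[OF i]]
      using blk_lt_trans[OF A[OF i] lt] blk_lt_irrefl[OF A[OF i], of w] blk_lt_mem[OF lt] UA[OF i] by blast
    then show ?thesis using True i by (auto simp: decr_def)
  qed
  have "(\<Sum>V | compatible N R V. (-1::real) ^ length V) = (-1) ^ card N"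
  proof (rule sum_compatible[OF disj ne])
    fix N' assume N': "N' \<subseteq> N" "N' \<noteq> {}"
    then obtain b0 where "b0 \<in> N'" "b0 \<noteq> {}" using ne by (metis ex_in_conv subsetD)
    then have "\<Union>N' \<noteq> {}" by blast
    \<comment> \<open>The minimal block is that of an element with \<open>y\<close> maximal and,
      among those, \<open>\<rho>\<close> minimal. A predecessor under \<open>R\<close> has larger
      \<open>y\<close>, or at least the same \<open>y\<close> and smaller \<open>\<rho>\<close>;
      both functions are constant on blocks.\<close>
    then obtain x1 where x1: "x1 \<in> \<Union>N'" "\<And>w. w \<in> \<Union>N' \<Longrightarrow> y w \<le> y x1"
      using finite_ex_max[of "\<Union>N'" y] by auto
    obtain x0 where x0: "x0 \<in> \<Union>N'" "y x0 = y x1"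
      "\<And>w. w \<in> \<Union>N' \<Longrightarrow> y w = y x1 \<Longrightarrow> - \<rho> w \<le> - \<rho> x0"
      by (rule finite_ex_max[of "{x \<in> \<Union>N'. y x = y x1}" "\<lambda>x. - \<rho> x"]) (use x1 in auto)
    then obtain b where b: "b \<in> N'" "x0 \<in> b" by blast
    have "\<not> R w x" if "x \<in> b" "w \<in> \<Union>N'" for x w
    proof
      assume R: "R w x"
      have eq: "y x = y x1" "\<rho> x = \<rho> x0" using y_block[of b x x0] \<rho>_block[of b x x0] that b N'(1) x0(2) by auto
      have "\<not> y x < y w" using x1(2)[OF that(2)] eq by simp
      then obtain i where "i \<in> I" "blk_lt (A i) w x" using R by (auto simp: R_def)
      then have "\<rho> w < \<rho> x" "y x \<le> y w" using \<rho>_less y_le by blast+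
      then show False using x0(3)[OF that(2)] x1(2)[OF that(2)] eq by simp
    qed
    then show "\<exists>b\<in>N'. \<forall>x\<in>b. \<forall>w\<in>\<Union>N'. \<not> R w x" using b(1) by blast
  qed
  moreover have "compatible N R V \<longleftrightarrow> osp UNIV V \<and> decr y V \<and> (\<forall>i\<in>I. subword (A i) V)" for V
  proof (cases "osp UNIV V")
    case V: True
    have sub: "subword (A i) V \<longleftrightarrow> (\<forall>b\<in>set (A i). \<exists>B\<in>set V. b \<subseteq> B) \<and>
        (\<forall>w x. blk_lt (A i) w x \<longrightarrow> blk_lt V w x)" if "i \<in> I" for i
      using subword_iff[OF A[OF that] V] .
    have dec: "decr y V \<longleftrightarrow> (\<forall>w x. y x < y w \<longrightarrow> blk_lt V w x)"
      using decr_iff[OF V, of y] by simp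
    have "compatible N R V \<longleftrightarrow> (\<forall>b\<in>N. \<exists>B\<in>set V. b \<subseteq> B) \<and> (\<forall>w x. R w x \<longrightarrow> blk_lt V w x)"
      using V by (simp add: compatible_def UN)
    also have "(\<forall>b\<in>N. \<exists>B\<in>set V. b \<subseteq> B) \<longleftrightarrow> (\<forall>i\<in>I. \<forall>b\<in>set (A i). \<exists>B\<in>set V. b \<subseteq> B)"
      unfolding N_def by (rule ball_UN)
    also have "(\<forall>w x. R w x \<longrightarrow> blk_lt V w x) \<longleftrightarrow>
        decr y V \<and> (\<forall>i\<in>I. \<forall>w x. blk_lt (A i) w x \<longrightarrow> blk_lt V w x)"
      unfolding dec R_def by metis
    also have "(\<forall>i\<in>I. \<forall>b\<in>set (A i). \<exists>B\<in>set V. b \<subseteq> B) \<and>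
        decr y V \<and> (\<forall>i\<in>I. \<forall>w x. blk_lt (A i) w x \<longrightarrow> blk_lt V w x) \<longleftrightarrow>
        decr y V \<and> (\<forall>i\<in>I. subword (A i) V)"
      by (simp only: sub ball_conj_distrib cong: ball_cong) auto
    finally show ?thesis using V by simp
  next
    case False
    then show ?thesis by (simp add: compatible_def UN)
  qed
  ultimately show ?thesis using True by simp
qed

lemma prepend_block_osp:
  assumes "osp U S" "U \<inter> T = {}"
  shows "osp (T \<union> U) (prepend_block T S)"
proof -
  have "T \<union> U - T = U" using assms(2) by blast
  then show ?thesis using assms(1) by (auto simp: prepend_block_def osp_Cons)
qed

lemma minus_one_powi_diff: "(-1::real) powi (int m - int k) = (-1) ^ m * (-1) ^ k"
  by (simp add: power_int_diff power_int_of_nat) (cases "even k"; simp)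

text \<open>The theorem on the dual side, at one fixed \<open>y\<close>. After summing over all
  \<open>V\<close>, these are grouped by the tuple \<open>\<sigma>\<close> of rotations that they
  contain linearly; each group is evaluated by \<open>signed_sum_common_refinements\<close>, and the
  sum over tuples is the expanded product.\<close>

lemma cyclic_signed_sum:
  fixes T :: "'n::{finite,linorder} set" and y :: "'n \<Rightarrow> real" and l m :: nat
  assumes l: "l \<ge> 1"
    and U: "\<And>i. i\<in>{1..l} \<Longrightarrow> U i \<noteq> {}" "disjoint_family_on U {1..l}" "(\<Union>i\<in>{1..l}. U i) = UNIV - T"
    and S: "\<And>i. i\<in>{1..l} \<Longrightarrow> osp (U i) (S i)"
    and m: "m = (if T = {} then 0 else 1) + (\<Sum>i=1..l. length (S i))"
  defines "A \<equiv> \<lambda>i. prepend_block T (S i)"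
  shows "(\<Prod>i\<in>{1..l}. \<Sum>j<length (A i). of_bool (decr y (rotate j (A i)))) =
    (\<Sum>L | standard_osp UNIV L \<and> (\<forall>i\<in>{1..l}. \<exists>j<length L. subword (A i) (rotate j L)).
       (-1) powi (int m - int (length L)) * (\<Sum>j<length L. (of_bool (decr y (rotate j L)) :: real)))"
proof -
  let ?I = "{1..l}"
  have UT: "U i \<inter> T = {}" if "i \<in> ?I" for i using U(3) that by blast
  have A: "osp (T \<union> U i) (A i)" if "i \<in> ?I" for i
    unfolding A_def using S UT that by (intro prepend_block_osp) auto
  have A_ne: "A i \<noteq> []" if "i \<in> ?I" for i using A[OF that] U(1)[OF that] by auto
  have cover: "(\<Union>i\<in>?I. T \<union> U i) = UNIV"
  proof -
    have "1 \<in> ?I" using l by simp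
    then show ?thesis using U(3) by blast
  qed
  define N where "N = (\<Union>i\<in>?I. set (A i))"
  have block: "b \<noteq> {}" "b \<subseteq> U i" if "i \<in> ?I" "b \<in> set (S i)" for i b
    using S[OF that(1)] that(2) by (auto simp: osp_def partition_on_def)
  \<comment> \<open>The sets \<open>U i\<close> being disjoint, the blocks of different
    \<open>S i\<close> are distinct, while a nonempty \<open>T\<close> is one block common to all
    words.\<close>
  have cardN: "card N = m"
  proof -
    have "card (\<Union>i\<in>?I. set (S i)) = (\<Sum>i\<in>?I. card (set (S i)))"
    proof (rule card_UN_disjoint)
      show "\<forall>i\<in>?I. \<forall>j\<in>?I. i \<noteq> j \<longrightarrow> set (S i) \<inter> set (S j) = {}"
      proof (intro ballI impI, rule ccontr)
        fix i j assume ij: "i \<in> ?I" "j \<in> ?I" "i \<noteq> j" "set (S i) \<inter> set (S j) \<noteq> {}"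
        then obtain b where "b \<in> set (S i)" "b \<in> set (S j)" by blast
        then show False
          using block[OF ij(1)] block[OF ij(2)] disjoint_family_onD[OF U(2) ij(1-3)] by blast
      qed
    qed auto
    also have "\<dots> = (\<Sum>i=1..l. length (S i))"
      using S by (intro sum.cong) (auto simp: osp_def distinct_card)
    finally have c: "card (\<Union>i\<in>?I. set (S i)) = (\<Sum>i=1..l. length (S i))" .
    show ?thesis
    proof (cases "T = {}")
      case True
      then show ?thesis using c by (simp add: N_def A_def prepend_block_def m)
    next
      case False
      have "T \<notin> (\<Union>i\<in>?I. set (S i))" using block UT False by blast
      moreover have "N = insert T (\<Union>i\<in>?I. set (S i))"
        using False l by (auto simp: N_def A_def prepend_block_def)
      ultimately show ?thesis using c False by (simp add: m)
    qed
  qed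
  define g where "g V = (-1) ^ m * (-1) ^ length V * (of_bool (decr y V) :: real)" for V :: "'n set list"
  define P where "P L \<longleftrightarrow> (\<forall>i\<in>?I. \<exists>j<length L. subword (A i) (rotate j L))" for L
  define \<Phi> where "\<Phi> = (\<Pi>\<^sub>E i\<in>?I. {..<length (A i)})"
  define Q where "Q \<sigma> = {V. osp UNIV V \<and> decr y V \<and> (\<forall>i\<in>?I. subword (rotate (\<sigma> i) (A i)) V)}" for \<sigma>
  have P_rot: "P L \<longleftrightarrow> (\<forall>i\<in>?I. \<exists>j<length (A i). subword (rotate j (A i)) (rotate q L))" if "L \<noteq> []" for L q
    unfolding P_def using cyclic_subword_rotate[OF A_ne that] by blast
  \<comment> \<open>By \<open>P_rot\<close> with shifts 0 and \<open>j\<close>, both sides are the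
    same linear condition on \<open>rotate j L\<close>.\<close>
  have P_inv: "P (rotate j L) \<longleftrightarrow> P L" if "L \<noteq> []" for L j
    using P_rot[of "rotate j L" 0] P_rot[OF that, of j] that by simp
  have "(\<Sum>L | standard_osp UNIV L \<and> P L.
       (-1) powi (int m - int (length L)) * (\<Sum>j<length L. (of_bool (decr y (rotate j L)) :: real)))
     = (\<Sum>L | standard_osp UNIV L \<and> P L. \<Sum>j<length L. g (rotate j L))"
    by (simp only: g_def minus_one_powi_diff sum_distrib_left length_rotate)
  also have "\<dots> = (\<Sum>V | osp UNIV V \<and> P V. g V)" by (rule sum_standard_osp_rotate) (rule P_inv)
  also have "\<dots> = (\<Sum>V | osp UNIV V \<and> P V \<and> decr y V. (-1) ^ m * (-1) ^ length V)"
    using finite_osp[of "UNIV :: 'n set"]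
    by (intro sum.mono_neutral_cong_right) (auto simp: g_def intro: rev_finite_subset)
  also have "{V. osp UNIV V \<and> P V \<and> decr y V} = (\<Union>\<sigma>\<in>\<Phi>. Q \<sigma>)"
  proof (intro equalityI subsetI)
    fix V assume "V \<in> {V. osp UNIV V \<and> P V \<and> decr y V}"
    then have V: "osp UNIV V" "P V" "decr y V" by auto
    then have "V \<noteq> []" by auto
    then have "\<forall>i\<in>?I. \<exists>j<length (A i). subword (rotate j (A i)) V" using P_rot[of V 0] V(2) by simp
    then obtain \<sigma> where \<sigma>: "\<forall>i\<in>?I. \<sigma> i < length (A i) \<and> subword (rotate (\<sigma> i) (A i)) V" by metis
    have "restrict \<sigma> ?I \<in> \<Phi>" "V \<in> Q (restrict \<sigma> ?I)" using \<sigma> V by (auto simp: \<Phi>_def Q_def)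
    then show "V \<in> (\<Union>\<sigma>\<in>\<Phi>. Q \<sigma>)" by blast
  next
    fix V assume "V \<in> (\<Union>\<sigma>\<in>\<Phi>. Q \<sigma>)"
    then obtain \<sigma> where \<sigma>: "\<sigma> \<in> \<Phi>" "V \<in> Q \<sigma>" by blast
    then have V: "osp UNIV V" "decr y V" "\<forall>i\<in>?I. subword (rotate (\<sigma> i) (A i)) V" by (auto simp: Q_def)
    moreover have "\<forall>i\<in>?I. \<sigma> i < length (A i)" using \<sigma>(1) by (auto simp: \<Phi>_def)
    moreover have "V \<noteq> []" using V(1) by auto
    ultimately have "P V" using P_rot[of V 0] by auto
    then show "V \<in> {V. osp UNIV V \<and> P V \<and> decr y V}" using V by simp
  qed
  also have "(\<Sum>V\<in>(\<Union>\<sigma>\<in>\<Phi>. Q \<sigma>). (-1) ^ m * (-1) ^ length V) =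
    (\<Sum>\<sigma>\<in>\<Phi>. \<Sum>V\<in>Q \<sigma>. (-1::real) ^ m * (-1) ^ length V)"
  proof (rule sum.UNION_disjoint)
    show "finite \<Phi>" unfolding \<Phi>_def by (intro finite_PiE) auto
    show "\<forall>\<sigma>\<in>\<Phi>. finite (Q \<sigma>)"
      using finite_osp[of "UNIV :: 'n set"] by (auto simp: Q_def intro: rev_finite_subset)
    \<comment> \<open>The tuple is recovered from \<open>V\<close>: restricting \<open>V\<close> to
      the elements of \<open>A i\<close> yields \<open>rotate (\<sigma> i) (A i)\<close>, and
      rotations of a list with distinct entries differ.\<close>
    have "\<sigma> = \<tau>" if \<sigma>\<tau>: "\<sigma> \<in> \<Phi>" "\<tau> \<in> \<Phi>" "V \<in> Q \<sigma>" "V \<in> Q \<tau>" for \<sigma> \<tau> V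
    proof (rule PiE_ext)
      show "\<sigma> \<in> (\<Pi>\<^sub>E i\<in>?I. {..<length (A i)})" "\<tau> \<in> (\<Pi>\<^sub>E i\<in>?I. {..<length (A i)})"
        using \<sigma>\<tau> by (auto simp: \<Phi>_def)
      fix i assume i: "i \<in> ?I"
      have "rotate (\<sigma> i) (A i) = rotate (\<tau> i) (A i)"
        using \<sigma>\<tau>(3,4) i by (auto simp: Q_def subword_restr)
      moreover have "\<sigma> i < length (A i)" "\<tau> i < length (A i)" using \<sigma>\<tau>(1,2) i by (auto simp: \<Phi>_def)
      ultimately show "\<sigma> i = \<tau> i" using rotate_distinct_inj osp_distinct[OF A[OF i]] by blast
    qed
    then show "\<forall>\<sigma>\<in>\<Phi>. \<forall>\<tau>\<in>\<Phi>. \<sigma> \<noteq> \<tau> \<longrightarrow> Q \<sigma> \<inter> Q \<tau> = {}" by blast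
  qed
  also have "\<dots> = (\<Sum>\<sigma>\<in>\<Phi>. \<Prod>i\<in>?I. of_bool (decr y (rotate (\<sigma> i) (A i))))"
  proof (rule sum.cong[OF refl])
    fix \<sigma>
    have "(\<Sum>V\<in>Q \<sigma>. (-1::real) ^ length V) = (-1) ^ card (\<Union>i\<in>?I. set (rotate (\<sigma> i) (A i))) *
      of_bool (\<forall>i\<in>?I. decr y (rotate (\<sigma> i) (A i)))"
      unfolding Q_def
    proof (rule signed_sum_common_refinements[OF _ _ U(2) cover])
      show "osp (T \<union> U i) (rotate (\<sigma> i) (A i))" if "i \<in> ?I" for i using A[OF that] by (simp add: osp_rotate)
      show "T \<in> set (rotate (\<sigma> i) (A i))" if "T \<noteq> {}" for i using that by (simp add: A_def prepend_block_def)
    qed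
    \<comment> \<open>Rotating a word keeps its set of blocks, so every tuple gives the sign
      \<open>(-1) ^ m\<close>, which the prefactor cancels.\<close>
    also have "(\<Union>i\<in>?I. set (rotate (\<sigma> i) (A i))) = N" by (simp add: N_def)
    finally have "(\<Sum>V\<in>Q \<sigma>. (-1::real) ^ m * (-1) ^ length V) = of_bool (\<forall>i\<in>?I. decr y (rotate (\<sigma> i) (A i)))"
      by (simp add: cardN flip: sum_distrib_left power_mult_distrib mult.assoc)
    also have "\<dots> = (\<Prod>i\<in>?I. of_bool (decr y (rotate (\<sigma> i) (A i))))"
      by (auto simp: of_bool_def prod_zero_iff)
    finally show "(\<Sum>V\<in>Q \<sigma>. (-1::real) ^ m * (-1) ^ length V) = (\<Prod>i\<in>?I. of_bool (decr y (rotate (\<sigma> i) (A i))))" .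
  qed
  also have "\<dots> = (\<Prod>i\<in>?I. \<Sum>j<length (A i). of_bool (decr y (rotate j (A i))))"
    unfolding \<Phi>_def by (rule prod_sum_PiE[symmetric]) auto
  finally show ?thesis unfolding P_def by simp
qed

section \<open>Duality\<close>

text \<open>Taken inside \<open>V0\<close> rather than in the whole space, so that duals again
  satisfy \<open>polyhedral_cone\<close>.\<close>

definition dual_cone :: "(real^'n) set \<Rightarrow> (real^'n) set" where
  "dual_cone C = {y \<in> V0. \<forall>x\<in>C. 0 \<le> x \<bullet> y}"

lemma polyhedral_cone_V0: "polyhedral_cone V0"
  unfolding polyhedral_cone_def
  by (intro conjI affine_imp_polyhedron subspace_imp_affine subspace_imp_convex_cone subspace_V0 order_refl)

lemma polyhedral_cone_halfspaces:
  assumes "finite A"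
  shows "polyhedral_cone (V0 \<inter> {x. \<forall>a\<in>A. a \<bullet> x \<le> 0})"
proof -
  have "convex_cone (\<Inter>{V0, {x. \<forall>a\<in>A. a \<bullet> x \<le> 0}})"
    using polyhedral_cone_V0 polyhedron_homogeneous(2)[OF assms]
    by (intro convex_cone_Inter) (auto simp: polyhedral_cone_def)
  then show ?thesis
    using polyhedral_cone_V0 polyhedron_homogeneous(1)[OF assms] by (auto simp: polyhedral_cone_def)
qed

lemma polyhedral_cone_halfspace: "polyhedral_cone (V0 \<inter> {x. 0 \<le> y \<bullet> x})"
  using polyhedral_cone_halfspaces[of "{- y}"] by simp

lemma polyhedral_cone_0: "polyhedral_cone C \<Longrightarrow> 0 \<in> C"
  by (simp add: polyhedral_cone_def convex_cone_contains_0)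

lemma polyhedral_cone_dual:
  assumes "polyhedral_cone C"
  shows "polyhedral_cone (dual_cone C)"
proof -
  obtain S where S: "finite S" "C = convex_cone hull S"
    using assms polyhedral_convex_cone_finitely_generated unfolding polyhedral_cone_def by metis
  have "(\<forall>x\<in>C. 0 \<le> x \<bullet> y) \<longleftrightarrow> (\<forall>a\<in>uminus ` S. a \<bullet> y \<le> 0)" for y
  proof
    assume "\<forall>a\<in>uminus ` S. a \<bullet> y \<le> 0"
    then have "S \<subseteq> {x. y \<bullet> x \<ge> 0}" by (auto simp: inner_commute)
    then have "convex_cone hull S \<subseteq> {x. y \<bullet> x \<ge> 0}" by (rule hull_minimal) (rule convex_cone_halfspace_ge)
    then show "\<forall>x\<in>C. 0 \<le> x \<bullet> y" using S(2) by (auto simp: inner_commute)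
  qed (use S hull_subset[of S convex_cone] in auto)
  then have "dual_cone C = V0 \<inter> {x. \<forall>a\<in>uminus ` S. a \<bullet> x \<le> 0}" by (auto simp: dual_cone_def)
  then show ?thesis using polyhedral_cone_halfspaces[of "uminus ` S"] S(1) by simp
qed

lemma dual_cone_dual_cone:
  fixes C :: "(real^'n) set"
  assumes "polyhedral_cone C"
  shows "dual_cone (dual_cone C) = C"
proof
  have "C \<subseteq> V0" using assms by (simp add: polyhedral_cone_def)
  then show "C \<subseteq> dual_cone (dual_cone C)"
    unfolding dual_cone_def by (auto simp: inner_commute)
  obtain A where A: "finite A" "C = {x. \<forall>a\<in>A. a \<bullet> x \<le> 0}"
    using assms unfolding polyhedral_cone_def by (elim conjE polyhedral_convex_cone_homogeneous)
  show "dual_cone (dual_cone C) \<subseteq> C"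
  proof
    fix x assume x: "x \<in> dual_cone (dual_cone C)"
    have "a \<bullet> x \<le> 0" if "a \<in> A" for a
    proof -
      \<comment> \<open>\<open>p\<close> is the orthogonal projection of \<open>- a\<close> to
        \<open>V0\<close>, obtained by removing the mean of the coordinates; it defines the same
        functional as \<open>- a\<close> on \<open>V0\<close>.\<close>
      define \<mu> where "\<mu> = (\<Sum>i\<in>UNIV. a $ i) / CARD('n)"
      define p where "p = (\<chi> i. \<mu>) - a"
      have p: "z \<bullet> p = - (a \<bullet> z)" if "z \<in> V0" for z
      proof -
        have "z \<bullet> (\<chi> i. \<mu>) = \<mu> * (\<Sum>i\<in>UNIV. z $ i)"
          by (simp add: inner_vec_def sum_distrib_left mult.commute)
        then show ?thesis using that by (simp add: p_def V0_def inner_diff_right inner_commute)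
      qed
      have "p \<in> V0" by (simp add: p_def V0_def sum_subtractf \<mu>_def)
      moreover have "0 \<le> c \<bullet> p" if "c \<in> C" for c
        using p[of c] that A(2) assms \<open>a \<in> A\<close> by (auto simp: polyhedral_cone_def)
      ultimately have "p \<in> dual_cone C" by (simp add: dual_cone_def)
      then have "0 \<le> p \<bullet> x" "x \<in> V0" using x by (auto simp: dual_cone_def)
      then show ?thesis using p[of x] by (simp add: inner_commute)
    qed
    then show "x \<in> C" using A(2) by simp
  qed
qed

lemma dual_cone_minkowski_sum:
  assumes "0 \<in> C" "0 \<in> D"
  shows "dual_cone (minkowski_sum C D) = dual_cone C \<inter> dual_cone D"
proof -
  have "C \<subseteq> minkowski_sum C D" "D \<subseteq> minkowski_sum C D"
    using assms by (force simp: minkowski_sum_def)+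
  then have "dual_cone (minkowski_sum C D) \<subseteq> dual_cone C \<inter> dual_cone D"
    unfolding dual_cone_def by blast
  moreover have "dual_cone C \<inter> dual_cone D \<subseteq> dual_cone (minkowski_sum C D)"
    by (auto simp: dual_cone_def minkowski_sum_def inner_add_left)
  ultimately show ?thesis by blast
qed

text \<open>The graph of the linear extension of \<open>[C] \<mapsto> [dual_cone C]\<close>. The factors \<open>1 *\<close> make the rule an
  instance of the bilinearity clauses of the convolution.\<close>

inductive dual_pair :: "(real^'n \<Rightarrow> real) \<Rightarrow> (real^'n \<Rightarrow> real) \<Rightarrow> bool" where
  zero: "dual_pair (\<lambda>_. 0) (\<lambda>_. 0)"
| add: "polyhedral_cone C \<Longrightarrow> dual_pair f g \<Longrightarrow>
    dual_pair (\<lambda>x. a * indicator C x + 1 * f x) (\<lambda>y. a * indicator (dual_cone C) y + 1 * g y)"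

lemma dual_pair_cone_span: "dual_pair f g \<Longrightarrow> f \<in> cone_span"
proof (induction rule: dual_pair.induct)
  case (add C f g a)
  then show ?case by (intro cone_span_lincomb indicator_cone_span)
qed (rule zero_cone_span)

lemma dual_pair_indicator:
  "polyhedral_cone C \<Longrightarrow> dual_pair (indicator C) (indicator (dual_cone C))"
  using dual_pair.add[OF _ dual_pair.zero, of C 1] by simp

lemma dual_pair_add:
  assumes "dual_pair f g" "dual_pair f' g'"
  shows "dual_pair (\<lambda>x. f x + f' x) (\<lambda>x. g x + g' x)"
  using assms(1)
proof induction
  case zero
  then show ?case using assms(2) by simp
next
  case (add C f g a)
  from dual_pair.add[OF add(1) add.IH, of a] show ?case by (simp add: add.assoc)
qed

lemma dual_pair_scale:
  assumes "dual_pair f g"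
  shows "dual_pair (\<lambda>x. c * f x) (\<lambda>x. c * g x)"
  using assms
proof induction
  case zero
  then show ?case using dual_pair.zero by simp
next
  case (add C f g a)
  from dual_pair.add[OF add(1) add.IH, of "c * a"] show ?case by (simp add: algebra_simps)
qed

lemma dual_pair_sum:
  assumes "finite I" "\<And>i. i \<in> I \<Longrightarrow> dual_pair (f i) (g i)"
  shows "dual_pair (\<lambda>x. \<Sum>i\<in>I. f i x) (\<lambda>x. \<Sum>i\<in>I. g i x)"
  using assms by (induction I) (simp_all add: dual_pair.zero dual_pair_add)

text \<open>On cones this is the fact that the dual of a Minkowski sum is the intersection of the
  duals; two inductions extend it bilinearly.\<close>

lemma dual_pair_convolution:
  assumes "dual_pair f g" "dual_pair f' g'"
  shows "dual_pair (f \<bullet>\<^sub>c f') (\<lambda>x. g x * g' x)"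
proof -
  have base: "dual_pair (indicator C \<bullet>\<^sub>c f') (\<lambda>x. indicator (dual_cone C) x * g' x)"
    if C: "polyhedral_cone C" for C
    using assms(2)
  proof induction
    case zero
    then show ?case using dual_pair.zero by (simp add: convolution_zero indicator_cone_span C)
  next
    case (add D f g a)
    have "dual_pair (indicator (minkowski_sum C D)) (indicator (dual_cone (minkowski_sum C D)))"
      by (intro dual_pair_indicator polyhedral_cone_minkowski_sum C add)
    moreover have "(indicator (dual_cone (minkowski_sum C D)) :: _ \<Rightarrow> real) =
        (\<lambda>x. indicator (dual_cone C) x * indicator (dual_cone D) x)"
      using C add(1) by (simp add: dual_cone_minkowski_sum polyhedral_cone_0 indicator_inter_arith fun_eq_iff)
    ultimately have "dual_pair (\<lambda>x. a * indicator (minkowski_sum C D) x + 1 * (indicator C \<bullet>\<^sub>c f) x)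
      (\<lambda>x. a * (indicator (dual_cone C) x * indicator (dual_cone D) x) + 1 * (indicator (dual_cone C) x * g x))"
      using add.IH by (intro dual_pair_add dual_pair_scale) auto
    then show ?case
      unfolding convolution_lincomb_right[OF indicator_cone_span[OF add(1)] dual_pair_cone_span[OF add(2)] indicator_cone_span[OF C]]
        convolution_indicator[OF C add(1)]
      by (simp add: algebra_simps)
  qed
  show ?thesis using assms(1)
  proof induction
    case zero
    then show ?case using dual_pair.zero dual_pair_cone_span[OF assms(2)] by (simp add: convolution_zero)
  next
    case (add C f g a)
    have "dual_pair (\<lambda>x. a * (indicator C \<bullet>\<^sub>c f') x + 1 * (f \<bullet>\<^sub>c f') x)
      (\<lambda>x. a * (indicator (dual_cone C) x * g' x) + 1 * (g x * g' x))"
      using add.IH base[OF add(1)] by (intro dual_pair_add dual_pair_scale)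
    then show ?case
      unfolding convolution_lincomb_left[OF indicator_cone_span[OF add(1)] dual_pair_cone_span[OF add(2)] dual_pair_cone_span[OF assms(2)]]
      by (simp add: algebra_simps)
  qed
qed

text \<open>Biduality of polyhedral cones, extended linearly. It turns the evaluation of the second
  component from the first into injectivity.\<close>

lemma dual_pair_sym: "dual_pair f g \<Longrightarrow> dual_pair g f"
proof (induction rule: dual_pair.induct)
  case (add C f g a)
  from dual_pair.add[OF polyhedral_cone_dual[OF add(1)] add.IH, of a]
  show ?case by (simp add: dual_cone_dual_cone add(1))
qed (rule dual_pair.zero)

text \<open>For \<open>y \<noteq> 0\<close> the Minkowski sum of \<open>C\<close> and the
  halfspace \<open>{x \<in> V0. 0 \<le> x \<bullet> y}\<close> contains \<open>- y\<close> iff \<open>y\<close> is not in the dual cone of \<open>C\<close>.\<close>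

lemma dual_pair_eval:
  assumes "dual_pair f g"
  shows "g y = (if y \<notin> V0 then 0 else (f \<bullet>\<^sub>c indicator V0) (- y) -
    (if y = 0 then 0 else (f \<bullet>\<^sub>c indicator (V0 \<inter> {x. 0 \<le> y \<bullet> x})) (- y)))"
  using assms
proof induction
  case zero
  then show ?case
    by (simp add: convolution_zero indicator_cone_span polyhedral_cone_V0 polyhedral_cone_halfspace)
next
  case (add C f g a)
  let ?H = "V0 \<inter> {x. 0 \<le> y \<bullet> x}"
  have H: "polyhedral_cone ?H" by (rule polyhedral_cone_halfspace)
  have CV: "C \<subseteq> V0" "0 \<in> C" using add(1) by (auto simp: polyhedral_cone_def convex_cone_contains_0)
  \<comment> \<open>For \<open>y\<close> in \<open>V0\<close> the term with \<open>V0\<close> is the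
    constant 1, written as a convolution so that the formula is linear in \<open>f\<close>. At
    \<open>y = 0\<close> the halfspace is all of \<open>V0\<close> and the difference would be 0,
    although 0 lies in the dual cone; hence the separate case.\<close>
  have inC: "indicator (dual_cone C) y = (if y \<notin> V0 then 0 else
     indicator (minkowski_sum C V0) (- y) - (if y = 0 then 0 else indicator (minkowski_sum C ?H) (- y) :: real))"
  proof (cases "y \<in> V0")
    case True
    then have my: "- y \<in> V0" using subspace_neg[OF subspace_V0] by blast
    then have V: "- y \<in> minkowski_sum C V0" using CV unfolding minkowski_sum_def by force
    show ?thesis
    proof (cases "y = 0")
      case True
      then show ?thesis using V \<open>y \<in> V0\<close> by (simp add: dual_cone_def indicator_def)
    next
      case y0: False
      have "- y \<in> minkowski_sum C ?H \<longleftrightarrow> y \<notin> dual_cone C"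
      proof
        assume "- y \<in> minkowski_sum C ?H"
        then obtain c h where ch: "- y = c + h" "c \<in> C" "0 \<le> y \<bullet> h" by (auto simp: minkowski_sum_def)
        have "(- y) \<bullet> y = c \<bullet> y + h \<bullet> y" using ch(1) by (simp add: inner_add_left)
        then have "c \<bullet> y < 0" using ch(3) y0 by (simp add: inner_commute) (smt (verit) inner_gt_zero_iff)
        then show "y \<notin> dual_cone C" using ch(2) unfolding dual_cone_def by (metis (mono_tags, lifting) mem_Collect_eq not_less)
      next
        assume "y \<notin> dual_cone C"
        then obtain c where c: "c \<in> C" "c \<bullet> y < 0" using True by (auto simp: dual_cone_def)
        \<comment> \<open>Chosen so that the remainder \<open>- y - t *\<^sub>R c\<close> is
          orthogonal to \<open>y\<close>, hence on the boundary of the halfspace.\<close>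
        define t where "t = - (y \<bullet> y) / (c \<bullet> y)"
        have "t \<ge> 0" using c(2) by (simp add: t_def divide_nonneg_neg)
        then have tc: "t *\<^sub>R c \<in> C" using c(1) add(1) convex_cone_scaleR unfolding polyhedral_cone_def by blast
        have "- y - t *\<^sub>R c \<in> V0" using my tc CV subspace_diff[OF subspace_V0] by blast
        moreover have "y \<bullet> (- y - t *\<^sub>R c) = 0"
          using c(2) by (simp add: inner_diff_right t_def inner_commute)
        ultimately have "- y - t *\<^sub>R c \<in> ?H" by simp
        then show "- y \<in> minkowski_sum C ?H" using tc unfolding minkowski_sum_def by force
      qed
      then show ?thesis using V True y0 by (simp add: indicator_def)
    qed
  qed (simp add: dual_cone_def)
  show ?case
    unfolding inC add.IH
      convolution_lincomb_left[OF indicator_cone_span[OF add(1)] dual_pair_cone_span[OF add(2)] indicator_cone_span[OF H]]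
      convolution_lincomb_left[OF indicator_cone_span[OF add(1)] dual_pair_cone_span[OF add(2)] indicator_cone_span[OF polyhedral_cone_V0]]
      convolution_indicator[OF add(1) H] convolution_indicator[OF add(1) polyhedral_cone_V0]
    by (auto simp: algebra_simps)
qed

lemma dual_pair_inj:
  assumes "dual_pair f g" "dual_pair f' g"
  shows "f = f'"
proof
  fix x
  show "f x = f' x"
    using dual_pair_eval[OF dual_pair_sym[OF assms(1)], of x]
      dual_pair_eval[OF dual_pair_sym[OF assms(2)], of x] by simp
qed

lemma dual_pair_convolution_prod:
  assumes "\<And>i. i \<in> {1..Suc l} \<Longrightarrow> dual_pair (F i) (G i)"
  shows "dual_pair (convolution_prod (Suc l) F) (\<lambda>y. \<Prod>i\<in>{1..Suc l}. G i y)"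
  using assms
proof (induction l)
  case 0
  then show ?case by (simp add: convolution_prod_def)
next
  case (Suc l)
  have "convolution_prod (Suc (Suc l)) F = convolution_prod (Suc l) F \<bullet>\<^sub>c F (Suc (Suc l))"
    by (simp add: convolution_prod_def)
  moreover have "dual_pair (convolution_prod (Suc l) F \<bullet>\<^sub>c F (Suc (Suc l)))
      (\<lambda>y. (\<Prod>i\<in>{1..Suc l}. G i y) * G (Suc (Suc l)) y)"
    using Suc by (intro dual_pair_convolution) auto
  ultimately show ?case by simp
qed

section \<open>Duals of plates and blades\<close>

lemma inner_sum_axis: "(\<Sum>i\<in>S. axis i 1) \<bullet> x = (\<Sum>i\<in>S. x $ i :: real)"
  by (simp add: inner_sum_left inner_axis')

lemma polyhedral_cone_plate: "polyhedral_cone (plate Vs)"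
proof -
  define A where "A = (\<lambda>i. axis i 1) ` (- \<Union>(set Vs)) \<union> (\<lambda>i. - axis i (1::real)) ` (- \<Union>(set Vs)) \<union>
    (\<lambda>j. - (\<Sum>i\<in>\<Union>(set (take j Vs)). axis i (1::real))) ` {1..<length Vs}"
  have "plate Vs = V0 \<inter> {x. \<forall>a\<in>A. a \<bullet> x \<le> 0}"
    unfolding plate_def A_def
    by (auto simp: inner_axis' inner_sum_axis ball_Un order_antisym)
  then show ?thesis using polyhedral_cone_halfspaces[of A] by (simp add: A_def)
qed

lemma blk_le_take:
  "osp X V \<Longrightarrow> blk_le V x z \<Longrightarrow> z \<in> \<Union>(set (take j V)) \<Longrightarrow> x \<in> \<Union>(set (take j V))"
proof (induction V arbitrary: X j)
  case (Cons B V)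
  then obtain k where k: "j = Suc k" by (cases j) auto
  have V: "osp (X - B) V" "\<Union>(set V) = X - B" using Cons.prems(1) by (auto simp: osp_Cons osp_Union)
  show ?case
  proof (cases "x \<in> B")
    case False
    then have le: "blk_le V x z" using Cons.prems(2) by auto
    have "z \<notin> B" using blk_le_mem[OF le] V(2) by blast
    then show ?thesis using le Cons.IH[OF V(1), of k] Cons.prems(3) k by auto
  qed (use k in auto)
qed auto

text \<open>Summation by parts: the inner product combines the partial sums of \<open>x\<close> with
  the nonnegative drops of \<open>y\<close> between consecutive blocks as weights. In the induction
  \<open>p\<close> is the sum of \<open>x\<close> over the blocks already removed and
  \<open>c\<close> the value of \<open>y\<close> on the last of them.\<close>

lemma decr_inner_nonneg_aux:
  fixes x y :: "'n::finite \<Rightarrow> real"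
  assumes "osp X V" "decr y V" "\<And>j. j < length V \<Longrightarrow> 0 \<le> p + (\<Sum>i\<in>\<Union>(set (take j V)). x i)"
    and "p + (\<Sum>i\<in>X. x i) = 0" "\<And>i. i \<in> X \<Longrightarrow> y i \<le> c"
  shows "0 \<le> p * c + (\<Sum>i\<in>X. x i * y i)"
  using assms
proof (induction V arbitrary: X p c)
  case (Cons B V)
  have B: "B \<noteq> {}" "B \<subseteq> X" "osp (X - B) V" using Cons.prems(1) by (auto simp: osp_Cons)
  note UV = osp_Union[OF B(3)]
  obtain b where b: "b \<in> B" using B(1) by blast
  have le: "y z \<le> y w" if "blk_le (B # V) w z" for w z using Cons.prems(2) that by (auto simp: decr_def)
  have yB: "y i = y b" if "i \<in> B" for i using le[of i b] le[of b i] b that by auto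
  have splits: "(\<Sum>i\<in>X. f i) = (\<Sum>i\<in>B. f i) + (\<Sum>i\<in>X - B. f i)" for f :: "'n \<Rightarrow> real"
    using B(2) by (metis add.commute finite sum.subset_diff)
  define p' where "p' = p + (\<Sum>i\<in>B. x i)"
  have "0 \<le> p' * y b + (\<Sum>i\<in>X - B. x i * y i)"
  proof (rule Cons.IH[OF B(3)])
    show "decr y V" using Cons.prems(2) by (auto simp: decr_def)
    show "0 \<le> p' + (\<Sum>i\<in>\<Union>(set (take j V)). x i)" if "j < length V" for j
    proof -
      have "\<Union>(set (take j V)) \<subseteq> X - B" using UV set_take_subset[of j V] by blast
      then have "(\<Sum>i\<in>\<Union>(set (take (Suc j) (B # V))). x i) = (\<Sum>i\<in>B. x i) + (\<Sum>i\<in>\<Union>(set (take j V)). x i)"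
        by (simp, subst sum.union_disjoint) auto
      then show ?thesis using Cons.prems(3)[of "Suc j"] that by (simp add: p'_def)
    qed
    show "p' + (\<Sum>i\<in>X - B. x i) = 0" using Cons.prems(4) splits[of x] by (simp add: p'_def)
    show "y i \<le> y b" if "i \<in> X - B" for i using le[of b i] b that UV by auto
  qed
  moreover have "(\<Sum>i\<in>X. x i * y i) = (\<Sum>i\<in>B. x i) * y b + (\<Sum>i\<in>X - B. x i * y i)"
    using splits[of "\<lambda>i. x i * y i"] yB by (simp add: sum_distrib_right)
  moreover have "p * y b \<le> p * c"
    using Cons.prems(3)[of 0] Cons.prems(5)[of b] b B(2) by (intro mult_left_mono) auto
  ultimately show ?case by (simp add: p'_def algebra_simps)
qed simp

text \<open>In one direction \<open>y\<close> is tested against differences of unit vectors: for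
  \<open>x\<close> no later than \<open>z\<close>, every prefix containing \<open>z\<close> contains
  \<open>x\<close>, so the difference lies in the plate. The other direction is summation by
  parts.\<close>

lemma dual_cone_plate:
  fixes Vs :: "'n::finite set list"
  assumes "osp X Vs"
  shows "dual_cone (plate Vs) = {y \<in> V0. decr (($) y) Vs}"
proof (intro equalityI subsetI)
  fix y assume y: "y \<in> dual_cone (plate Vs)"
  have "y $ z \<le> y $ x" if le: "blk_le Vs x z" for x z
  proof -
    define e where "e = axis x 1 - (axis z 1 :: real^'n)"
    have sum_e: "(\<Sum>i\<in>S. e $ i) = of_bool (x \<in> S) - of_bool (z \<in> S)" for S
      by (simp add: e_def axis_def sum_subtractf of_bool_def)
    have "e \<in> plate Vs"
      unfolding plate_def mem_Collect_eq sum_e V0_def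
      using blk_le_take[OF assms le] blk_le_mem[OF le] by (auto simp: e_def axis_def)
    then have "0 \<le> e \<bullet> y" using y by (auto simp: dual_cone_def)
    then show ?thesis by (simp add: e_def inner_diff_left inner_axis')
  qed
  then show "y \<in> {y \<in> V0. decr (($) y) Vs}" using y by (auto simp: dual_cone_def decr_def)
next
  fix y assume "y \<in> {y \<in> V0. decr (($) y) Vs}"
  then have y: "y \<in> V0" "decr (($) y) Vs" by auto
  have "0 \<le> x \<bullet> y" if x: "x \<in> plate Vs" for x
  proof -
    have x0: "x $ i = 0" if "i \<notin> X" for i using x that osp_Union[OF assms] by (auto simp: plate_def)
    have full: "(\<Sum>i\<in>UNIV. x $ i * f i) = (\<Sum>i\<in>X. x $ i * f i)" for f
      using x0 by (intro sum.mono_neutral_right) auto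
    \<comment> \<open>Nothing has been removed at the start, so \<open>p = 0\<close>, and any upper
      bound of \<open>y\<close> serves as \<open>c\<close>.\<close>
    have "0 \<le> 0 * Max (range (($) y)) + (\<Sum>i\<in>X. x $ i * y $ i)"
    proof (rule decr_inner_nonneg_aux[OF assms y(2)])
      show "0 \<le> 0 + (\<Sum>i\<in>\<Union>(set (take j Vs)). x $ i)" if "j < length Vs" for j
        using x that by (cases "j = 0") (auto simp: plate_def)
      show "0 + (\<Sum>i\<in>X. x $ i) = 0" using x full[of "\<lambda>_. 1"] by (simp add: plate_def V0_def)
    qed simp
    then show ?thesis using full[of "($) y"] by (simp add: inner_vec_def)
  qed
  then show "y \<in> dual_cone (plate Vs)" using y by (simp add: dual_cone_def)
qed

lemma dual_pair_blade:
  fixes Vs :: "'n::finite set list"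
  assumes "osp X Vs"
  shows "dual_pair (blade Vs)
    (\<lambda>y. indicator V0 y * (\<Sum>j<length Vs. of_bool (decr (($) y) (rotate j Vs))))"
proof -
  have "indicator (dual_cone (plate (rotate j Vs))) =
      (\<lambda>y. indicator V0 y * of_bool (decr (($) y) (rotate j Vs)) :: real)" for j
    using dual_cone_plate[of X "rotate j Vs"] assms by (auto simp: osp_rotate indicator_def)
  then have "dual_pair (indicator (plate (rotate j Vs)))
     (\<lambda>y. indicator V0 y * of_bool (decr (($) y) (rotate j Vs)))" for j
    using dual_pair_indicator[OF polyhedral_cone_plate, of "rotate j Vs"] by (simp only:)
  then show ?thesis unfolding blade_def sum_distrib_left by (intro dual_pair_sum) auto
qed

text \<open>\<open>m\<close> is the number of distinct blocks in the words: the common block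
  \<open>T\<close> is counted once, and not at all when it is empty and omitted. The case of one
  word with \<open>T\<close> empty confirms this: \<open>S 1\<close> is then the only partition in
  the sum and must have coefficient 1.\<close>

theorem theorem27:
  fixes T :: "'n::{finite,linorder} set"
    and l m :: nat
    and U :: "nat \<Rightarrow> 'n set"
    and S :: "nat \<Rightarrow> 'n set list"
  assumes "l \<ge> 1"
    and "\<forall>i\<in>{1..l}. U i \<noteq> {}"
    and "disjoint_family_on U {1..l}"
    and "(\<Union>i\<in>{1..l}. U i) = UNIV - T"
    and "\<forall>i\<in>{1..l}. standard_osp (U i) (S i)"
    and "m = (if T = {} then 0 else 1) + (\<Sum>i=1..l. length (S i))"
  shows "convolution_prod l (\<lambda>i. blade (prepend_block T (S i))) =
    (\<lambda>x. \<Sum>Us | standard_osp UNIV Us \<and>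
                 (\<forall>i\<in>{1..l}. \<exists>j<length Us. subword (prepend_block T (S i)) (rotate j Us)).
           (-1) powi (int m - int (length Us)) * blade Us x)"
proof -
  let ?A = "\<lambda>i. prepend_block T (S i)"
  let ?L = "{Us. standard_osp UNIV Us \<and> (\<forall>i\<in>{1..l}. \<exists>j<length Us. subword (?A i) (rotate j Us))}"
  let ?c = "\<lambda>y L. \<Sum>j<length L. of_bool (decr (($) (y :: (real, 'n) vec)) (rotate j L)) :: real"
  have S: "osp (U i) (S i)" if "i \<in> {1..l}" for i using assms(5) that by (auto simp: standard_osp_def)
  obtain k where k: "l = Suc k" using assms(1) by (cases l) auto
  have "dual_pair (convolution_prod (Suc k) (\<lambda>i. blade (?A i)))
      (\<lambda>y. \<Prod>i\<in>{1..Suc k}. indicator V0 y * ?c y (?A i))"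
  proof (rule dual_pair_convolution_prod)
    fix i assume i: "i \<in> {1..Suc k}"
    have "U i \<inter> T = {}" using assms(4) i k by blast
    with S[of i] have "osp (T \<union> U i) (?A i)" using i k by (intro prepend_block_osp) auto
    then show "dual_pair (blade (?A i)) (\<lambda>y. indicator V0 y * ?c y (?A i))" by (rule dual_pair_blade)
  qed
  moreover have "(\<Prod>i\<in>{1..Suc k}. indicator V0 y * ?c y (?A i)) =
     (\<Sum>L\<in>?L. (-1) powi (int m - int (length L)) * (indicator V0 y * ?c y L))" for y
  proof -
    \<comment> \<open>The indicator is 0 or 1 and there is at least one factor, so its power
      collapses to a single copy.\<close>
    have "(\<Prod>i\<in>{1..Suc k}. indicator V0 y * ?c y (?A i)) = indicator V0 y * (\<Prod>i\<in>{1..l}. ?c y (?A i))"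
      by (simp add: prod.distrib k indicator_def)
    also have "(\<Prod>i\<in>{1..l}. ?c y (?A i)) = (\<Sum>L\<in>?L. (-1) powi (int m - int (length L)) * ?c y L)"
      by (rule cyclic_signed_sum[OF assms(1) _ assms(3,4) S assms(6)]) (use assms(2) in auto)
    finally show ?thesis by (simp add: sum_distrib_left mult_ac)
  qed
  moreover have "dual_pair (\<lambda>x. \<Sum>L\<in>?L. (-1) powi (int m - int (length L)) * blade L x)
      (\<lambda>y. \<Sum>L\<in>?L. (-1) powi (int m - int (length L)) * (indicator V0 y * ?c y L))"
  proof (rule dual_pair_sum)
    show "finite ?L"
      using finite_osp[of "UNIV :: 'n set"] by (rule rev_finite_subset) (auto simp: standard_osp_def)
    fix L assume "L \<in> ?L"
    then have "osp UNIV L" by (simp add: standard_osp_def)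
    then show "dual_pair (\<lambda>x. (-1) powi (int m - int (length L)) * blade L x)
      (\<lambda>y. (-1) powi (int m - int (length L)) * (indicator V0 y * ?c y L))"
      by (intro dual_pair_scale dual_pair_blade)
  qed
  ultimately show ?thesis using dual_pair_inj k by (simp only:)
qed

end
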